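(* Let $H_1$ and $H_2$ be maximal sectorial relations in a Hilbert space $\mathfrak{H}$, with $A_j^{1/2}$, $A_{js}^{1/2}$, $B_j$ ($j=1,2$) and $B_\oplus=B_1\oplus B_2$ as in the context, and let $K\subset(\mathfrak{H}\times\mathfrak{H})\times\mathfrak{H}$ be the linear relation $$K=\Big\{\big\{\{(I+iB_1)A_{1s}^{1/2}f,(I+iB_2)A_{2s}^{1/2}f\},f_1'+f_2'\big\}:\ \{(I+iB_1)A_{1s}^{1/2}f,f_1'\}\in A_1^{1/2},\ \{(I+iB_2)A_{2s}^{1/2}f,f_2'\}\in A_2^{1/2}\Big\}.$$ The Krein extension of $H_1+H_2$ is given by $$(H_1+H_2)_K=K^{**}(I+iB_\oplus)K^{*}.$$ If, in addition, the closures $\mathfrak{E}$ and $\mathfrak{D}$ in $\mathfrak{H}\times\mathfrak{H}$ of $$\mathfrak{E}_0=\{\{A_{1s}^{1/2}f,A_{2s}^{1/2}f\}:f\in\operatorname{dom}H_1\cap\operatorname{dom}H_2\},$$ $$\mathfrak{D}_0=\{\{(I+iB_1)A_{1s}^{1/2}f,(I+iB_2)A_{2s}^{1/2}f\}:f\in\operatorname{dom}H_1\cap\operatorname{dom}H_2\}$$ satisfy $\mathfrak{E}=\mathfrak{D}$, then the closed sectorial form corresponding to $(H_1+H_2)_K$ is given by $$\mathfrak{t}_K[f,g]=\big((I+iB_\oplus)(K^{*})_sf,(K^{*})_sg\big),\quad f,g\in\operatorname{dom}\mathfrak{t}_K=\operatorname{dom}K^{*}.$$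
   Context: Hilbert spaces are complex with inner product linear in the first entry; $\mathbf{B}(\mathfrak{H})$ is the set of bounded everywhere defined operators on $\mathfrak{H}$. A linear relation $T$ from $\mathfrak{H}$ to $\mathfrak{K}$ is a linear subspace of $\mathfrak{H}\times\mathfrak{K}$; operators are identified with their graphs. $\operatorname{dom}T$ is the set of first entries, $\ker T=\{f:\{f,0\}\in T\}$, $\operatorname{mul}T=\{k:\{0,k\}\in T\}$, $T^{-1}=\{\{g,f\}:\{f,g\}\in T\}$. The adjoint is $T^*=\{\{k,h\}\in\mathfrak{K}\times\mathfrak{H}:(k,f')=(h,f)\ \forall\{f,f'\}\in T\}$; $T^{**}$ is the closure of $T$. Products: $AB=\{\{f,h\}:\{f,g\}\in B,\ \{g,h\}\in A\text{ for some }g\}$; sums: $A+B=\{\{f,g+h\}:\{f,g\}\in A,\ \{f,h\}\in B\}$. The (orthogonal) operator part of a closed relation $R$ is the operator $R_s=\{\{f,g\}\in R:g\perp\operatorname{mul}R\}$, with $\operatorname{dom}R_s=\operatorname{dom}R$. A relation $S$ in $\mathfrak{H}$ is sectorial (vertex at the origin, semi-angle $\alpha\in[0,\pi/2)$) if $|\operatorname{Im}(h',h)|\le(\tan\alpha)\operatorname{Re}(h',h)$ for all $\{h,h'\}\in S$; it is maximal sectorial if it has no proper sectorial extension in $\mathfrak{H}$. If $S$ is sectorial, so is $S^{-1}$. For sectorial $S$ the form $\mathfrak{t}_S[\varphi,\psi]=(\varphi',\psi)$, $\{\varphi,\varphi'\},\{\psi,\psi'\}\in S$, $\operatorname{dom}\mathfrak{t}_S=\operatorname{dom}S$,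 is well defined, sectorial and closable. Closed (not necessarily densely defined) sectorial forms $\mathfrak{t}$ and maximal sectorial relations are in one-to-one correspondence via $H_{\mathfrak{t}}=\{\{\varphi,\varphi'\}:\varphi\in\operatorname{dom}\mathfrak{t},\ \mathfrak{t}[\varphi,\psi]=(\varphi',\psi)\ \forall\psi\in\operatorname{dom}\mathfrak{t}\}$. The Friedrichs extension $S_F$ is the maximal sectorial relation corresponding to the closure of $\mathfrak{t}_S$; the Krein extension is $S_K=((S^{-1})_F)^{-1}$. Pair data. For $j=1,2$ let $\mathfrak{t}_{H_j}$ be the closed sectorial form corresponding to $H_j$, and let $A_j$ be the nonnegative selfadjoint relation corresponding to the closed nonnegative form $\operatorname{Re}\mathfrak{t}_{H_j}$, where $(\operatorname{Re}\mathfrak{t})[h,k]=\tfrac12(\mathfrak{t}[h,k]+\overline{\mathfrak{t}[k,h]})$. Write $A_j=A_{js}\oplus(\{0\}\times\operatorname{mul}A_j)$, where $A_{js}$ is the operator part of $A_j$, a nonnegative selfadjoint operator in $\mathfrak{H}\ominus\operatorname{mul}A_j$; $A_{js}^{1/2}$ is its nonnegative square root and $A_j^{1/2}=A_{js}^{1/2}\oplus(\{0\}\times\operatorname{mul}A_j)$. $B_j\in\mathbf{B}(\mathfrak{H})$ is the unique selfadjoint operator, zero on $\ker A_j\oplus\operatorname{mul}A_j$, such that $\mathfrak{t}_{H_j}[h,k]=((I+iB_j)A_{js}^{1/2}h,A_{js}^{1/2}k)$ for $h,k\in\operatorname{dom}\mathfrak{t}_{H_j}=\operatorname{dom}A_j^{1/2}$;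 then $H_j=A_j^{1/2}(I+iB_j)A_j^{1/2}$. $B_\oplus=B_1\oplus B_2$ is the orthogonal sum acting in $\mathfrak{H}\times\mathfrak{H}$. The sum $H_1+H_2$ is a sectorial relation with domain $\operatorname{dom}H_1\cap\operatorname{dom}H_2$. In the definition of $K$, the vector $f$ ranges over those $f\in\operatorname{dom}A_1^{1/2}\cap\operatorname{dom}A_2^{1/2}$ for which such $f_1',f_2'$ exist, i.e. over $\operatorname{dom}H_1\cap\operatorname{dom}H_2$, so $\operatorname{dom}K=\mathfrak{D}_0$. *)

theory Defs
  imports "HOL-Analysis.Analysis"
begin

text \<open>
  A complex Hilbert space is a complete real inner product space whose scalar
  multiplication and inner product are restrictions of complex ones: the real inner
  product is the real part of the complex one.  In particular norm, topology and
  completeness are those of the library.  The complex inner product is linear in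
  the first argument.
\<close>

class complex_inner = real_inner +
  fixes scaleC :: "complex \<Rightarrow> 'a \<Rightarrow> 'a" (infixr "*\<^sub>C" 75)
    and cinner :: "'a \<Rightarrow> 'a \<Rightarrow> complex"
  assumes scaleC_add_right: "c *\<^sub>C (x + y) = c *\<^sub>C x + c *\<^sub>C y"
    and scaleC_add_left: "(c + d) *\<^sub>C x = c *\<^sub>C x + d *\<^sub>C x"
    and scaleC_scaleC: "c *\<^sub>C d *\<^sub>C x = (c * d) *\<^sub>C x"
    and scaleC_one: "1 *\<^sub>C x = x"
    and scaleR_scaleC: "r *\<^sub>R x = complex_of_real r *\<^sub>C x"
    and cinner_commute: "cinner x y = cnj (cinner y x)"
    and cinner_add_left: "cinner (x + y) z = cinner x z + cinner y z"
    and cinner_scaleC_left: "cinner (c *\<^sub>C x) y = c * cinner x y"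
    and inner_eq_Re_cinner: "inner x y = Re (cinner x y)"

class chilbert_space = complex_inner + complete_space

instantiation prod :: (complex_inner, complex_inner) complex_inner
begin

definition scaleC_prod_def: "c *\<^sub>C p = (c *\<^sub>C fst p, c *\<^sub>C snd p)"

definition cinner_prod_def: "cinner p q = cinner (fst p) (fst q) + cinner (snd p) (snd q)"

instance
proof
  fix c d :: complex and r :: real and x y z :: "'a \<times> 'b"
  show "c *\<^sub>C (x + y) = c *\<^sub>C x + c *\<^sub>C y"
    by (simp add: scaleC_prod_def scaleC_add_right)
  show "(c + d) *\<^sub>C x = c *\<^sub>C x + d *\<^sub>C x"
    by (simp add: scaleC_prod_def scaleC_add_left)
  show "c *\<^sub>C d *\<^sub>C x = (c * d) *\<^sub>C x"
    by (simp add: scaleC_prod_def scaleC_scaleC)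
  show "1 *\<^sub>C x = x"
    by (simp add: scaleC_prod_def scaleC_one)
  show "r *\<^sub>R x = complex_of_real r *\<^sub>C x"
    by (simp add: scaleC_prod_def scaleR_scaleC prod_eq_iff)
  show "cinner x y = cnj (cinner y x)"
    by (metis cinner_prod_def cinner_commute complex_cnj_add)
  show "cinner (x + y) z = cinner x z + cinner y z"
    by (simp add: cinner_prod_def cinner_add_left)
  show "cinner (c *\<^sub>C x) y = c * cinner x y"
    by (simp add: cinner_prod_def scaleC_prod_def cinner_scaleC_left distrib_left)
  show "inner x y = Re (cinner x y)"
    by (simp add: cinner_prod_def inner_prod_def inner_eq_Re_cinner)
qed

end

instance prod :: (chilbert_space, chilbert_space) chilbert_space ..

definition csubspace :: "'a::complex_inner set \<Rightarrow> bool" where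
  "csubspace V \<longleftrightarrow> 0 \<in> V \<and> (\<forall>x\<in>V. \<forall>y\<in>V. x + y \<in> V) \<and> (\<forall>c. \<forall>x\<in>V. c *\<^sub>C x \<in> V)"

definition orth :: "'a::complex_inner set \<Rightarrow> 'a set" where
  "orth V = {x. \<forall>k\<in>V. cinner x k = 0}"

definition bounded_op :: "('a::complex_inner \<Rightarrow> 'b::complex_inner) \<Rightarrow> bool" where
  "bounded_op T \<longleftrightarrow> bounded_linear T \<and> (\<forall>c x. T (c *\<^sub>C x) = c *\<^sub>C T x)"

definition selfadjoint_op :: "('a::complex_inner \<Rightarrow> 'a) \<Rightarrow> bool" where
  "selfadjoint_op T \<longleftrightarrow> bounded_op T \<and> (\<forall>x y. cinner (T x) y = cinner x (T y))"


subsection \<open>Linear relations\<close>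

text \<open>
  A linear relation is a set of pairs that is a linear subspace of the product space.
  Its domain is \<open>Domain\<close>, its inverse is \<open>converse\<close>.
\<close>

definition ker_rel :: "('a::complex_inner \<times> 'b::complex_inner) set \<Rightarrow> 'a set" where
  "ker_rel T = {f. (f, 0) \<in> T}"

definition mul_rel :: "('a::complex_inner \<times> 'b::complex_inner) set \<Rightarrow> 'b set" where
  "mul_rel T = {k. (0, k) \<in> T}"

definition adj_rel ::
    "('a::complex_inner \<times> 'b::complex_inner) set \<Rightarrow> ('b \<times> 'a) set" where
  "adj_rel T = {(k, h). \<forall>(f, f') \<in> T. cinner k f' = cinner h f}"

text \<open>The product \<open>A B\<close> applies \<open>B\<close> first, opposite to the order of arguments of \<open>O\<close>.\<close>

definition rel_prod :: "('b \<times> 'c) set \<Rightarrow> ('a \<times> 'b) set \<Rightarrow> ('a \<times> 'c) set"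
    (infixr "\<bullet>\<^sub>r" 75) where
  "A \<bullet>\<^sub>r B = B O A"

definition rel_sum :: "('a \<times> 'b::plus) set \<Rightarrow> ('a \<times> 'b) set \<Rightarrow> ('a \<times> 'b) set"
    (infixl "+\<^sub>r" 65) where
  "A +\<^sub>r B = {(f, g + h) | f g h. (f, g) \<in> A \<and> (f, h) \<in> B}"

definition op_part ::
    "('a::complex_inner \<times> 'b::complex_inner) set \<Rightarrow> ('a \<times> 'b) set" where
  "op_part R = {(f, g) \<in> R. g \<in> orth (mul_rel R)}"

definition op_graph :: "('a \<Rightarrow> 'b) \<Rightarrow> ('a \<times> 'b) set" where
  "op_graph T = {(x, T x) | x. True}"

text \<open>The value at \<open>f\<close> of an operator given by its graph; only used for single-valued \<open>R\<close>.\<close>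

definition rel_app :: "('a \<times> 'b) set \<Rightarrow> 'a \<Rightarrow> 'b" where
  "rel_app R f = (THE g. (f, g) \<in> R)"

definition sectorial :: "('a::complex_inner \<times> 'a) set \<Rightarrow> bool" where
  "sectorial S \<longleftrightarrow> csubspace S \<and>
     (\<exists>\<alpha>::real. 0 \<le> \<alpha> \<and> \<alpha> < pi / 2 \<and>
        (\<forall>(h, h') \<in> S. \<bar>Im (cinner h' h)\<bar> \<le> tan \<alpha> * Re (cinner h' h)))"

definition maximal_sectorial :: "('a::complex_inner \<times> 'a) set \<Rightarrow> bool" where
  "maximal_sectorial S \<longleftrightarrow> sectorial S \<and> (\<forall>T. sectorial T \<and> S \<subseteq> T \<longrightarrow> T = S)"


subsection \<open>Sesquilinear forms\<close>

text \<open>Only the values of \<open>form_val\<close> on \<open>form_dom\<close> are meaningful.\<close>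

record 'a cform =
  form_dom :: "'a set"
  form_val :: "'a \<Rightarrow> 'a \<Rightarrow> complex"

definition sesquilinear_form :: "'a::complex_inner cform \<Rightarrow> bool" where
  "sesquilinear_form t \<longleftrightarrow> csubspace (form_dom t) \<and>
     (\<forall>x\<in>form_dom t. \<forall>y\<in>form_dom t. \<forall>z\<in>form_dom t. \<forall>c.
        form_val t (x + y) z = form_val t x z + form_val t y z \<and>
        form_val t (c *\<^sub>C x) z = c * form_val t x z \<and>
        form_val t z (x + y) = form_val t z x + form_val t z y \<and>
        form_val t z (c *\<^sub>C x) = cnj c * form_val t z x)"

definition sectorial_form :: "'a::complex_inner cform \<Rightarrow> bool" where
  "sectorial_form t \<longleftrightarrow> sesquilinear_form t \<and>
     (\<exists>\<alpha>::real. 0 \<le> \<alpha> \<and> \<alpha> < pi / 2 \<and>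
        (\<forall>h\<in>form_dom t. \<bar>Im (form_val t h h)\<bar> \<le> tan \<alpha> * Re (form_val t h h)))"

text \<open>\<open>t\<close>-convergence of a sequence: \<open>u\<^sub>n \<longlonglongrightarrow> \<phi>\<close> and \<open>t[u\<^sub>m - u\<^sub>n] \<longlonglongrightarrow> 0\<close> as \<open>m, n \<rightarrow> \<infinity>\<close>.\<close>

definition form_conv :: "'a::complex_inner cform \<Rightarrow> (nat \<Rightarrow> 'a) \<Rightarrow> 'a \<Rightarrow> bool" where
  "form_conv t u \<phi> \<longleftrightarrow> (\<forall>n. u n \<in> form_dom t) \<and> u \<longlonglongrightarrow> \<phi> \<and>
     (\<forall>e>0. \<exists>N. \<forall>m\<ge>N. \<forall>n\<ge>N. cmod (form_val t (u m - u n) (u m - u n)) < e)"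

definition closed_form :: "'a::complex_inner cform \<Rightarrow> bool" where
  "closed_form t \<longleftrightarrow> (\<forall>u \<phi>. form_conv t u \<phi> \<longrightarrow>
     \<phi> \<in> form_dom t \<and> (\<lambda>n. form_val t (u n - \<phi>) (u n - \<phi>)) \<longlonglongrightarrow> 0)"

definition form_closure :: "'a::complex_inner cform \<Rightarrow> 'a cform" where
  "form_closure t =
     \<lparr>form_dom = {\<phi>. \<exists>u. form_conv t u \<phi>},
      form_val = (\<lambda>\<phi> \<psi>. THE l. \<forall>u v. form_conv t u \<phi> \<longrightarrow> form_conv t v \<psi> \<longrightarrow>
                     (\<lambda>n. form_val t (u n) (v n)) \<longlonglongrightarrow> l)\<rparr>"

definition re_form :: "'a cform \<Rightarrow> 'a cform" where
  "re_form t =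
     \<lparr>form_dom = form_dom t,
      form_val = (\<lambda>h k. (form_val t h k + cnj (form_val t k h)) / 2)\<rparr>"

definition form_rel :: "'a::complex_inner cform \<Rightarrow> ('a \<times> 'a) set" where
  "form_rel t = {(\<phi>, \<phi>'). \<phi> \<in> form_dom t \<and>
     (\<forall>\<psi>\<in>form_dom t. form_val t \<phi> \<psi> = cinner \<phi>' \<psi>)}"

text \<open>\<open>t\<close> is the closed sectorial form corresponding to the maximal sectorial relation \<open>H\<close>.\<close>

definition corresponding_form :: "'a::complex_inner cform \<Rightarrow> ('a \<times> 'a) set \<Rightarrow> bool" where
  "corresponding_form t H \<longleftrightarrow> sectorial_form t \<and> closed_form t \<and> form_rel t = H"

text \<open>The value is independent of the choice of \<open>\<phi>'\<close> when \<open>S\<close> is sectorial.\<close>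

definition rel_form :: "('a::complex_inner \<times> 'a) set \<Rightarrow> 'a cform" where
  "rel_form S =
     \<lparr>form_dom = Domain S,
      form_val = (\<lambda>\<phi> \<psi>. THE c. \<exists>\<phi>'. (\<phi>, \<phi>') \<in> S \<and> c = cinner \<phi>' \<psi>)\<rparr>"

definition friedrichs :: "('a::complex_inner \<times> 'a) set \<Rightarrow> ('a \<times> 'a) set" where
  "friedrichs S = form_rel (form_closure (rel_form S))"

definition krein :: "('a::complex_inner \<times> 'a) set \<Rightarrow> ('a \<times> 'a) set" where
  "krein S = (friedrichs (S\<inverse>))\<inverse>"


subsection \<open>Data attached to a pair of maximal sectorial relations\<close>

text \<open>
  \<open>R\<close> is the nonnegative square root of the operator part of the nonnegative selfadjoint
  relation \<open>A\<close>, taken in the Hilbert space orthogonal to \<open>mul A\<close>; selfadjointness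
  is therefore relative to that subspace.
\<close>

definition op_part_sqrt :: "('a::complex_inner \<times> 'a) set \<Rightarrow> ('a \<times> 'a) set \<Rightarrow> bool" where
  "op_part_sqrt A R \<longleftrightarrow> (let M = orth (mul_rel A) in
     csubspace R \<and> single_valued R \<and> R \<subseteq> M \<times> M \<and>
     (\<forall>(f, f') \<in> R. Im (cinner f' f) = 0 \<and> 0 \<le> Re (cinner f' f)) \<and>
     adj_rel R \<inter> M \<times> M = R \<and>
     R \<bullet>\<^sub>r R = op_part A)"

text \<open>The square root of \<open>A\<close>: the orthogonal sum of \<open>R\<close> and \<open>{0} \<times> mul A\<close>.\<close>

definition rel_sqrt :: "('a::complex_inner \<times> 'a) set \<Rightarrow> ('a \<times> 'a) set \<Rightarrow> ('a \<times> 'a) set" where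
  "rel_sqrt A R = {(f, g + k) | f g k. (f, g) \<in> R \<and> k \<in> mul_rel A}"

definition id_plus_i :: "('a::complex_inner \<Rightarrow> 'a) \<Rightarrow> 'a \<Rightarrow> 'a" where
  "id_plus_i B x = x + \<i> *\<^sub>C B x"

definition sectorial_data ::
    "('a::complex_inner \<times> 'a) set \<Rightarrow> 'a cform \<Rightarrow> ('a \<times> 'a) set \<Rightarrow> ('a \<times> 'a) set \<Rightarrow>
     ('a \<Rightarrow> 'a) \<Rightarrow> bool" where
  "sectorial_data H t A R B \<longleftrightarrow>
     corresponding_form t H \<and>
     A = form_rel (re_form t) \<and>
     op_part_sqrt A R \<and>
     selfadjoint_op B \<and>
     (\<forall>x\<in>ker_rel A. \<forall>y\<in>mul_rel A. B (x + y) = 0) \<and>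
     form_dom t = Domain (rel_sqrt A R) \<and>
     (\<forall>h\<in>form_dom t. \<forall>k\<in>form_dom t.
        form_val t h k = cinner (id_plus_i B (rel_app R h)) (rel_app R k))"

definition oplus :: "('a \<Rightarrow> 'a) \<Rightarrow> ('b \<Rightarrow> 'b) \<Rightarrow> 'a \<times> 'b \<Rightarrow> 'a \<times> 'b" where
  "oplus B1 B2 = (\<lambda>(x, y). (B1 x, B2 y))"

definition K_rel ::
    "('a::complex_inner \<times> 'a) set \<Rightarrow> ('a \<times> 'a) set \<Rightarrow> ('a \<Rightarrow> 'a) \<Rightarrow>
     ('a \<times> 'a) set \<Rightarrow> ('a \<times> 'a) set \<Rightarrow> ('a \<Rightarrow> 'a) \<Rightarrow> (('a \<times> 'a) \<times> 'a) set" where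
  "K_rel A1 R1 B1 A2 R2 B2 =
     {((id_plus_i B1 (rel_app R1 f), id_plus_i B2 (rel_app R2 f)), f1' + f2') | f f1' f2'.
        f \<in> Domain (rel_sqrt A1 R1) \<inter> Domain (rel_sqrt A2 R2) \<and>
        (id_plus_i B1 (rel_app R1 f), f1') \<in> rel_sqrt A1 R1 \<and>
        (id_plus_i B2 (rel_app R2 f), f2') \<in> rel_sqrt A2 R2}"

end

theory Submission imports Defs begin

text \<open>
  Put \<open>S = H\<^sub>1 + H\<^sub>2\<close>, \<open>E f = (R\<^sub>1 f, R\<^sub>2 f)\<close> and \<open>C = I + i B\<^sub>\<oplus>\<close>.  The representations of \<open>H\<^sub>1\<close> and
  \<open>H\<^sub>2\<close> give \<open>(h, g) = (C E f, E g)\<close> for \<open>{f, h} \<in> S\<close> and \<open>g \<in> dom S\<close>, and \<open>K\<close> consists of the pairs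
  \<open>{C E f, h}\<close>.  So the form of the inverse of \<open>S\<close> is \<open>[h, l] \<mapsto> (E f, C E g)\<close>.  As \<open>Re (C x, x) = \<parallel>x\<parallel>\<^sup>2\<close>,
  convergence in this form is convergence of \<open>h\<close> together with \<open>E f\<close>; hence its closure lives on the
  range of \<open>K\<^sup>*\<^sup>*\<close>, the closure of \<open>K\<close>, and sends \<open>\<phi>, \<psi>\<close> to \<open>(e, C e')\<close> when \<open>{C e, \<phi>}\<close> and
  \<open>{C e', \<psi>}\<close> lie in \<open>K\<^sup>*\<^sup>*\<close>.  Reading off the associated relation yields \<open>K\<^sup>*\<^sup>* C K\<^sup>*\<close>.
  In this product the intermediate vector \<open>w\<close> with \<open>{f, w} \<in> K\<^sup>*\<close> lies in the closure of \<open>E\<^sub>0\<close>; the operator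
  part of \<open>K\<^sup>*\<close> selects the \<open>w\<close> in the closure of \<open>D\<^sub>0 = dom K\<close>, so both agree if the closures do.
\<close>

subsection \<open>The complex inner product\<close>

lemma scaleC_zero_left [simp]: "0 *\<^sub>C (x::'a::complex_inner) = 0"
  using scaleR_scaleC[of 0 x] by simp

lemma scaleC_zero_right [simp]: "c *\<^sub>C (0::'a::complex_inner) = 0"
  using scaleC_add_right[of c 0 "0::'a"] by simp

lemma scaleC_minus_one: "(-1) *\<^sub>C (x::'a::complex_inner) = - x"
  using scaleR_scaleC[of "-1" x] by simp

lemma cinner_add_right: "cinner x (y + z) = cinner x y + cinner (x::'a::complex_inner) z"
  by (metis cinner_commute cinner_add_left complex_cnj_add)

lemma cinner_scaleC_right: "cinner (x::'a::complex_inner) (c *\<^sub>C y) = cnj c * cinner x y"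
  by (metis cinner_commute cinner_scaleC_left complex_cnj_mult)

lemma cinner_zero_left [simp]: "cinner 0 (x::'a::complex_inner) = 0"
  using cinner_scaleC_left[of 0 x x] by simp

lemma cinner_zero_right [simp]: "cinner (x::'a::complex_inner) 0 = 0"
  using cinner_scaleC_right[of x 0 x] by simp

lemma cinner_minus_left: "cinner (- x) (y::'a::complex_inner) = - cinner x y"
  using cinner_scaleC_left[of "-1" x y] by (simp add: scaleC_minus_one)

lemma cinner_minus_right: "cinner x (- y::'a::complex_inner) = - cinner x y"
  using cinner_scaleC_right[of x "-1" y] by (simp add: scaleC_minus_one)

lemma cinner_diff_left: "cinner (x - y) (z::'a::complex_inner) = cinner x z - cinner y z"
  using cinner_add_left[of x "-y" z] by (simp add: cinner_minus_left)

lemma cinner_diff_right: "cinner x (y - z::'a::complex_inner) = cinner x y - cinner x z"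
  using cinner_add_right[of x y "-z"] by (simp add: cinner_minus_right)

lemma cinner_self: "cinner x (x::'a::complex_inner) = complex_of_real ((norm x)\<^sup>2)"
proof (rule complex_eqI)
  show "Re (cinner x x) = Re (complex_of_real ((norm x)\<^sup>2))"
    by (simp add: power2_norm_eq_inner inner_eq_Re_cinner)
  have "Im (cinner x x) = - Im (cinner x x)"
    using arg_cong[OF cinner_commute[of x x], of Im] by simp
  then show "Im (cinner x x) = Im (complex_of_real ((norm x)\<^sup>2))" by simp
qed

lemma cinner_self_eq_0_iff [simp]: "cinner x x = 0 \<longleftrightarrow> (x::'a::complex_inner) = 0"
  by (simp add: cinner_self)

lemma norm_scaleC: "norm (c *\<^sub>C (x::'a::complex_inner)) = cmod c * norm x"
proof -
  have "complex_of_real ((norm (c *\<^sub>C x))\<^sup>2) = c * cnj c * cinner x x"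
    unfolding cinner_self[symmetric] by (simp add: cinner_scaleC_left cinner_scaleC_right)
  also have "\<dots> = complex_of_real ((cmod c * norm x)\<^sup>2)"
    by (simp only: cinner_self complex_norm_square[of c, symmetric] power_mult_distrib of_real_mult of_real_power)
  finally have "(norm (c *\<^sub>C x))\<^sup>2 = (cmod c * norm x)\<^sup>2"
    using of_real_eq_iff by blast
  then show ?thesis by (simp add: power2_eq_iff_nonneg)
qed

lemma cmod_cinner_le: "cmod (cinner x y) \<le> norm x * norm (y::'a::complex_inner)"
proof (cases "cinner x y = 0")
  case False
  \<comment> \<open>The unimodular \<open>u\<close> rotates \<open>cinner x y\<close> onto the
    positive real axis, where it equals a real inner product and the real Cauchy-Schwarz inequality
    applies.\<close>
  define u where "u = cnj (cinner x y) / cmod (cinner x y)"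
  have u: "cmod u = 1" using False by (simp add: u_def norm_divide)
  have "cinner (u *\<^sub>C x) y = complex_of_real (cmod (cinner x y))"
    using False complex_norm_square[of "cinner x y"]
    by (simp add: u_def cinner_scaleC_left power2_eq_square field_simps)
  then have "cmod (cinner x y) = inner (u *\<^sub>C x) y" by (simp add: inner_eq_Re_cinner)
  also have "\<dots> \<le> norm (u *\<^sub>C x) * norm y" by (rule norm_cauchy_schwarz)
  finally show ?thesis by (simp add: norm_scaleC u)
qed simp

lemma bounded_bilinear_cinner: "bounded_bilinear (cinner :: 'a::complex_inner \<Rightarrow> 'a \<Rightarrow> complex)"
proof
  show "\<exists>K. \<forall>a b::'a. cmod (cinner a b) \<le> norm a * norm b * K"
    using cmod_cinner_le by (intro exI[of _ 1]) auto
qed (simp_all add: cinner_add_left cinner_add_right scaleR_scaleC cinner_scaleC_left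
      cinner_scaleC_right scaleR_conv_of_real)

lemmas tendsto_cinner [tendsto_intros] = bounded_bilinear.tendsto[OF bounded_bilinear_cinner]

text \<open>Serves to extract limits from form convergence: both forms below dominate the squared
  norm of an associated sequence, and \<open>z\<close> stands for the modulus of the form on
  differences.\<close>

lemma Cauchy_if_norm_power2_le:
  fixes x :: "nat \<Rightarrow> 'a::real_normed_vector"
  assumes le: "\<And>m n. (norm (x m - x n))\<^sup>2 \<le> z m n"
    and small: "\<And>e::real. e > 0 \<Longrightarrow> \<exists>N. \<forall>m\<ge>N. \<forall>n\<ge>N. z m n < e"
  shows "Cauchy x"
proof (rule metric_CauchyI)
  fix e :: real assume e: "0 < e"
  then obtain N where N: "\<And>m n. m \<ge> N \<Longrightarrow> n \<ge> N \<Longrightarrow> z m n < e\<^sup>2"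
    using small[of "e\<^sup>2"] by auto
  have "dist (x m) (x n) < e" if "m \<ge> N" "n \<ge> N" for m n
  proof -
    have "(norm (x m - x n))\<^sup>2 < e\<^sup>2" using le N[OF that] by (rule order_le_less_trans)
    then show ?thesis using e by (simp add: dist_norm power_less_imp_less_base)
  qed
  then show "\<exists>M. \<forall>m\<ge>M. \<forall>n\<ge>M. dist (x m) (x n) < e" by blast
qed

lemma bounded_linear_scaleC: "bounded_linear (\<lambda>x. c *\<^sub>C (x::'a::complex_inner))"
  by (rule bounded_linear_intro[where K = "cmod c"])
    (simp_all add: scaleC_add_right scaleR_scaleC scaleC_scaleC norm_scaleC ac_simps)

lemmas tendsto_scaleC [tendsto_intros] = bounded_linear.tendsto[OF bounded_linear_scaleC]

subsection \<open>Subspaces and orthogonal projections\<close>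

lemma csubspaceD:
  assumes "csubspace V"
  shows csubspace_0: "0 \<in> V"
    and csubspace_add: "x \<in> V \<Longrightarrow> y \<in> V \<Longrightarrow> x + y \<in> V"
    and csubspace_scaleC: "x \<in> V \<Longrightarrow> c *\<^sub>C x \<in> V"
    and csubspace_diff: "x \<in> V \<Longrightarrow> y \<in> V \<Longrightarrow> x - y \<in> V"
proof -
  show a: "x + y \<in> V" if "x \<in> V" "y \<in> V" for x y using assms that by (simp add: csubspace_def)
  show s: "c *\<^sub>C x \<in> V" if "x \<in> V" for c x using assms that by (simp add: csubspace_def)
  show "0 \<in> V" using assms by (simp add: csubspace_def)
  show "x - y \<in> V" if "x \<in> V" "y \<in> V"
    using a[OF that(1) s[OF that(2), of "-1"]] by (simp add: scaleC_minus_one)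
qed

lemma csubspace_closure:
  assumes "csubspace V"
  shows "csubspace (closure V)"
  unfolding csubspace_def
proof (intro conjI ballI allI)
  show "0 \<in> closure V" using assms closure_subset by (auto simp: csubspace_def)
  fix x y assume "x \<in> closure V" "y \<in> closure V"
  then obtain u v where u: "\<And>n. u n \<in> V" "u \<longlonglongrightarrow> x" and v: "\<And>n. v n \<in> V" "v \<longlonglongrightarrow> y"
    unfolding closure_sequential by blast
  have "(\<lambda>n. u n + v n) \<longlonglongrightarrow> x + y" by (intro tendsto_intros u v)
  then show "x + y \<in> closure V"
    unfolding closure_sequential using csubspace_add[OF assms u(1) v(1)] by (intro exI[of _ "\<lambda>n. u n + v n"]) simp
next
  fix c x assume "x \<in> closure V"
  then obtain u where u: "\<And>n. u n \<in> V" "u \<longlonglongrightarrow> x"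
    unfolding closure_sequential by blast
  have "(\<lambda>n. c *\<^sub>C u n) \<longlonglongrightarrow> c *\<^sub>C x" by (intro tendsto_intros u)
  then show "c *\<^sub>C x \<in> closure V"
    unfolding closure_sequential using csubspace_scaleC[OF assms u(1)] by (intro exI[of _ "\<lambda>n. c *\<^sub>C u n"]) simp
qed

lemma csubspace_orth: "csubspace (orth V)"
  by (auto simp: csubspace_def orth_def cinner_add_left cinner_scaleC_left)

lemma closed_orth: "closed (orth V)"
  unfolding closed_sequential_limits
proof (intro allI impI)
  fix u x assume *: "(\<forall>n. u n \<in> orth V) \<and> u \<longlonglongrightarrow> x"
  have "cinner x k = 0" if "k \<in> V" for k
  proof -
    have "(\<lambda>n. cinner (u n) k) \<longlonglongrightarrow> cinner x k" using * by (intro tendsto_intros) auto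
    moreover have "cinner (u n) k = 0" for n using * that by (simp add: orth_def)
    ultimately show ?thesis by (simp add: LIMSEQ_const_iff)
  qed
  then show "x \<in> orth V" by (simp add: orth_def)
qed

lemma orthD: "x \<in> orth V \<Longrightarrow> k \<in> V \<Longrightarrow> cinner x k = 0"
  by (simp add: orth_def)

lemma orthD': "x \<in> orth V \<Longrightarrow> k \<in> V \<Longrightarrow> cinner k x = 0"
  by (metis orthD cinner_commute complex_cnj_zero)

lemma subset_orth_orth: "V \<subseteq> orth (orth V)"
  using orthD' by (auto simp: orth_def[of "orth V"])

lemma orth_closure: "orth (closure V) = orth V"
proof
  show "orth (closure V) \<subseteq> orth V" using closure_subset[of V] by (auto simp: orth_def)
  have "closure V \<subseteq> orth (orth V)"
    by (intro closure_minimal subset_orth_orth closed_orth)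
  then show "orth V \<subseteq> orth (closure V)"
    using orthD' by (fastforce simp: orth_def[of "closure V"])
qed

text \<open>Classical minimization: the parallelogram law makes a minimizing sequence Cauchy, and
  the first variation at its limit yields orthogonality.\<close>

lemma projection_exists:
  fixes V :: "'a::chilbert_space set"
  assumes V: "csubspace V" and cl: "closed V"
  obtains p where "p \<in> V" "x - p \<in> orth V"
proof -
  define F where "F = (\<lambda>v. (norm (x - v))\<^sup>2) ` V"
  have ne: "F \<noteq> {}" using csubspace_0[OF V] by (auto simp: F_def)
  have bdd: "bdd_below F" by (rule bdd_belowI[of _ 0]) (auto simp: F_def)
  have low: "Inf F \<le> (norm (x - v))\<^sup>2" if "v \<in> V" for v
    by (rule cInf_lower) (use that bdd in \<open>auto simp: F_def\<close>)
  have "\<exists>v\<in>V. (norm (x - v))\<^sup>2 < Inf F + 1 / real (Suc n)" for n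
  proof -
    have "Inf F < Inf F + 1 / real (Suc n)" by simp
    from cInf_lessD[OF ne this] show ?thesis by (auto simp: F_def)
  qed
  then obtain v where v: "\<And>n. v n \<in> V" "\<And>n. (norm (x - v n))\<^sup>2 < Inf F + 1 / real (Suc n)"
    by metis
  have dist: "(norm (v m - v n))\<^sup>2 \<le> 2 / real (Suc m) + 2 / real (Suc n)" for m n
  proof -
    have "(1/2) *\<^sub>R (v m + v n) \<in> V"
      using V v(1) by (simp add: scaleR_scaleC csubspace_add csubspace_scaleC)
    from low[OF this] have "Inf F \<le> (norm (x - (1/2) *\<^sub>R (v m + v n)))\<^sup>2" .
    \<comment> \<open>The parallelogram law for \<open>x - v m\<close> and \<open>x - v n\<close>.
      Their mean is \<open>x\<close> minus the midpoint of \<open>v m\<close> and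
      \<open>v n\<close>, which lies in \<open>V\<close>, so its squared norm is at least
      \<open>Inf F\<close>.\<close>
    moreover have "(norm (v m - v n))\<^sup>2 = 2 * (norm (x - v m))\<^sup>2 + 2 * (norm (x - v n))\<^sup>2
        - 4 * (norm (x - (1/2) *\<^sub>R (v m + v n)))\<^sup>2"
      by (simp add: power2_norm_eq_inner inner_simps inner_commute algebra_simps)
    ultimately show ?thesis using v(2)[of m] v(2)[of n] by simp
  qed
  have "Cauchy v"
  proof (rule metric_CauchyI)
    fix e :: real assume e: "0 < e"
    then obtain N where N: "1 / real (Suc N) < e\<^sup>2 / 4"
      using reals_Archimedean[of "e\<^sup>2 / 4"] by (auto simp: inverse_eq_divide)
    have "dist (v m) (v n) < e" if "m \<ge> N" "n \<ge> N" for m n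
    proof -
      have "1 / real (Suc m) \<le> 1 / real (Suc N)" "1 / real (Suc n) \<le> 1 / real (Suc N)"
        using that by (simp_all add: frac_le)
      with N dist[of m n] have "(norm (v m - v n))\<^sup>2 < e\<^sup>2" by simp
      then show ?thesis using e by (simp add: dist_norm power_less_imp_less_base)
    qed
    then show "\<exists>M. \<forall>m\<ge>M. \<forall>n\<ge>M. dist (v m) (v n) < e" by blast
  qed
  then obtain p where p: "v \<longlonglongrightarrow> p" using Cauchy_convergent_iff convergent_def by blast
  have pV: "p \<in> V" using cl v(1) p closed_sequentially by blast
  have "(\<lambda>n. (norm (x - v n))\<^sup>2) \<longlonglongrightarrow> (norm (x - p))\<^sup>2" by (intro tendsto_intros p)
  moreover have "(\<lambda>n. Inf F + 1 / real (Suc n)) \<longlonglongrightarrow> Inf F + 0"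
    using LIMSEQ_inverse_real_of_nat by (intro tendsto_intros) (simp add: inverse_eq_divide)
  ultimately have min: "(norm (x - p))\<^sup>2 \<le> Inf F"
    using v(2) by (simp add: LIMSEQ_le less_imp_le)
  have re: "inner (x - p) k = 0" if k: "k \<in> V" for k
  proof (rule ccontr)
    assume "inner (x - p) k \<noteq> 0"
    \<comment> \<open>This \<open>s\<close> minimizes the squared distance along the line through
      \<open>p\<close> in direction \<open>k\<close>; moving there would lower it by
      \<open>s * s * (norm k)\<^sup>2\<close>, against minimality.\<close>
    moreover define s where "s = inner (x - p) k / (norm k)\<^sup>2"
    ultimately have k0: "k \<noteq> 0" and s: "s * (norm k)\<^sup>2 = inner (x - p) k" "s \<noteq> 0" by auto
    have "p + s *\<^sub>R k \<in> V" using V pV k by (simp add: scaleR_scaleC csubspace_add csubspace_scaleC)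
    from order_trans[OF min low[OF this]]
    have "(norm (x - p))\<^sup>2 \<le> (norm ((x - p) - s *\<^sub>R k))\<^sup>2" by (simp add: algebra_simps)
    also have "\<dots> = (norm (x - p))\<^sup>2 - 2 * s * inner (x - p) k + s * (s * (norm k)\<^sup>2)"
      unfolding power2_norm_eq_inner
      by (simp add: inner_diff_left inner_diff_right inner_commute)
    also have "\<dots> = (norm (x - p))\<^sup>2 - s * (s * (norm k)\<^sup>2)" by (simp add: s(1)[symmetric])
    finally have "s * s * (norm k)\<^sup>2 \<le> 0" by simp
    moreover have "s * s * (norm k)\<^sup>2 > 0" using k0 s(2) by (auto simp: zero_less_mult_iff linorder_neq_iff)
    ultimately show False by simp
  qed
  have "cinner (x - p) k = 0" if k: "k \<in> V" for k
  proof (rule complex_eqI)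
    show "Re (cinner (x - p) k) = Re 0" using re[OF k] by (simp add: inner_eq_Re_cinner)
    \<comment> \<open>Real orthogonality to the vector \<open>\<i> *\<^sub>C k\<close>, which is
      also in \<open>V\<close>, is the vanishing of the imaginary part.\<close>
    show "Im (cinner (x - p) k) = Im 0"
      using re[OF csubspace_scaleC[OF V k, of \<i>]]
      by (simp add: inner_eq_Re_cinner cinner_scaleC_right)
  qed
  then show thesis using that pV by (simp add: orth_def)
qed

lemma orth_orth:
  fixes V :: "'a::chilbert_space set"
  assumes "csubspace V"
  shows "orth (orth V) = closure V"
proof
  show "closure V \<subseteq> orth (orth V)" by (intro closure_minimal subset_orth_orth closed_orth)
  show "orth (orth V) \<subseteq> closure V"
  proof
    fix x assume x: "x \<in> orth (orth V)"
    obtain p where p: "p \<in> closure V" "x - p \<in> orth (closure V)"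
      using projection_exists[OF csubspace_closure[OF assms] closed_closure] .
    then have "x - p \<in> orth V" by (simp add: orth_closure)
    with x p have "cinner x (x - p) = 0" "cinner p (x - p) = 0"
      using orthD orthD' by blast+
    then have "cinner (x - p) (x - p) = 0" by (simp add: cinner_diff_left)
    then show "x \<in> closure V" using p by simp
  qed
qed

subsection \<open>Adjoint relations\<close>

lemma adj_rel_iff: "(k, h) \<in> adj_rel T \<longleftrightarrow> (\<forall>f f'. (f, f') \<in> T \<longrightarrow> cinner k f' = cinner h f)"
  by (auto simp: adj_rel_def)

lemma adj_relD: "(k, h) \<in> adj_rel T \<Longrightarrow> (f, f') \<in> T \<Longrightarrow> cinner k f' = cinner h f"
  by (simp add: adj_rel_iff)

lemma csubspace_adj_rel: "csubspace (adj_rel T)"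
  by (auto simp: csubspace_def adj_rel_iff scaleC_prod_def zero_prod_def cinner_add_left
      cinner_scaleC_left)

lemma adj_rel_sequential:
  assumes "\<And>n. (u n, w n) \<in> adj_rel T" "u \<longlonglongrightarrow> k" "w \<longlonglongrightarrow> h"
  shows "(k, h) \<in> adj_rel T"
  unfolding adj_rel_iff
proof (intro allI impI)
  fix f f' assume f: "(f, f') \<in> T"
  have "(\<lambda>n. cinner (u n) f') \<longlonglongrightarrow> cinner k f'" "(\<lambda>n. cinner (w n) f) \<longlonglongrightarrow> cinner h f"
    by (intro tendsto_intros assms)+
  with adj_relD[OF assms(1) f] show "cinner k f' = cinner h f"
    by (simp add: LIMSEQ_unique)
qed

lemma closed_adj_rel: "closed (adj_rel T)"
  unfolding closed_sequential_limits
proof (intro allI impI)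
  fix u and x assume *: "(\<forall>n. u n \<in> adj_rel T) \<and> u \<longlonglongrightarrow> x"
  have "(fst x, snd x) \<in> adj_rel T"
    by (rule adj_rel_sequential[where u = "\<lambda>n. fst (u n)" and w = "\<lambda>n. snd (u n)"])
      (use * in \<open>auto intro: tendsto_intros\<close>)
  then show "x \<in> adj_rel T" by simp
qed

lemma subset_adj_adj: "T \<subseteq> adj_rel (adj_rel T)"
proof (rule subrelI)
  fix f f' assume "(f, f') \<in> T"
  then show "(f, f') \<in> adj_rel (adj_rel T)"
    unfolding adj_rel_iff[of f f'] by (metis adj_relD cinner_commute)
qed

text \<open>The adjoint is a rotated orthogonal complement: if \<open>(u, u')\<close> is orthogonal
  to \<open>T\<close>, then \<open>(u', - u)\<close> lies in \<open>adj_rel T\<close>. Pairing with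
  such elements places the double adjoint inside \<open>orth (orth T)\<close>, which is the
  closure.\<close>

lemma adj_adj_rel:
  fixes T :: "('a::chilbert_space \<times> 'b::chilbert_space) set"
  assumes "csubspace T"
  shows "adj_rel (adj_rel T) = closure T"
proof
  show "closure T \<subseteq> adj_rel (adj_rel T)"
    by (intro closure_minimal subset_adj_adj closed_adj_rel)
  show "adj_rel (adj_rel T) \<subseteq> closure T"
  proof (rule subrelI)
    fix f f' assume f: "(f, f') \<in> adj_rel (adj_rel T)"
    have "(f, f') \<in> orth (orth T)"
      unfolding orth_def[of "orth T"] mem_Collect_eq
    proof
      fix z assume z: "z \<in> orth T"
      obtain u u' where u: "z = (u, u')" by (cases z)
      have "(u', - u) \<in> adj_rel T"
        using orthD[OF z] unfolding adj_rel_iff u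
        by (fastforce simp: cinner_prod_def cinner_minus_left eq_neg_iff_add_eq_0 add.commute)
      from adj_relD[OF f this] show "cinner (f, f') z = 0"
        by (simp add: u cinner_prod_def cinner_minus_right neg_eq_iff_add_eq_0)
    qed
    then show "(f, f') \<in> closure T" by (simp add: orth_orth[OF assms])
  qed
qed

lemma mul_adj_rel: "mul_rel (adj_rel T) = orth (Domain T)"
  by (auto simp: mul_rel_def adj_rel_iff orth_def)

lemma csubspace_Domain:
  assumes "csubspace R"
  shows "csubspace (Domain R)"
  unfolding csubspace_def
proof (intro conjI ballI allI)
  show "0 \<in> Domain R" using csubspace_0[OF assms] by (auto simp: zero_prod_def)
  fix x c assume "x \<in> Domain R"
  then obtain x' where x: "(x, x') \<in> R" by blast
  show "c *\<^sub>C x \<in> Domain R" using csubspace_scaleC[OF assms x, of c] by (auto simp: scaleC_prod_def)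
  fix y assume "y \<in> Domain R"
  then obtain y' where y: "(y, y') \<in> R" by blast
  show "x + y \<in> Domain R" using csubspace_add[OF assms x y] by auto
qed

section \<open>Values of single-valued relations and operator parts of adjoints\<close>

lemma rel_app_eq: "single_valued R \<Longrightarrow> (f, g) \<in> R \<Longrightarrow> rel_app R f = g"
  unfolding rel_app_def by (rule the_equality) (auto dest: single_valuedD)

lemma rel_app_mem: "single_valued R \<Longrightarrow> f \<in> Domain R \<Longrightarrow> (f, rel_app R f) \<in> R"
  using rel_app_eq by fastforce

lemma rel_app_linear:
  assumes "csubspace R" "single_valued R" "f \<in> Domain R"
  shows rel_app_add: "g \<in> Domain R \<Longrightarrow> rel_app R (f + g) = rel_app R f + rel_app R g"
    and rel_app_diff: "g \<in> Domain R \<Longrightarrow> rel_app R (f - g) = rel_app R f - rel_app R g"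
    and rel_app_scaleC: "rel_app R (c *\<^sub>C f) = c *\<^sub>C rel_app R f"
proof -
  note f = rel_app_mem[OF assms(2,3)]
  show "rel_app R (f + g) = rel_app R f + rel_app R g" if "g \<in> Domain R"
    using csubspace_add[OF assms(1) f rel_app_mem[OF assms(2) that]] by (simp add: rel_app_eq[OF assms(2)])
  show "rel_app R (f - g) = rel_app R f - rel_app R g" if "g \<in> Domain R"
    using csubspace_diff[OF assms(1) f rel_app_mem[OF assms(2) that]] by (simp add: rel_app_eq[OF assms(2)])
  show "rel_app R (c *\<^sub>C f) = c *\<^sub>C rel_app R f"
    using csubspace_scaleC[OF assms(1) f, of c] by (simp add: scaleC_prod_def rel_app_eq[OF assms(2)])
qed

lemma csubspace_op_part:
  assumes "csubspace R"
  shows "csubspace (op_part R)"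
  unfolding csubspace_def
proof (intro conjI ballI allI)
  have iff: "x \<in> op_part R \<longleftrightarrow> x \<in> R \<and> snd x \<in> orth (mul_rel R)" for x
    by (cases x) (simp add: op_part_def)
  show "0 \<in> op_part R" by (simp add: iff csubspace_0 assms csubspace_orth)
  fix x c assume x: "x \<in> op_part R"
  then show "c *\<^sub>C x \<in> op_part R"
    using csubspace_scaleC[OF csubspace_orth, of "snd x" "mul_rel R" c] csubspace_scaleC[OF assms, of x c]
    by (simp add: iff scaleC_prod_def)
  fix y assume "y \<in> op_part R"
  with x show "x + y \<in> op_part R"
    by (simp add: iff csubspace_add assms csubspace_orth)
qed

lemma single_valued_op_part:
  assumes "csubspace R"
  shows "single_valued (op_part R)"
proof (rule single_valuedI)
  fix f g h assume "(f, g) \<in> op_part R" "(f, h) \<in> op_part R"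
  then have *: "(f, g) \<in> R" "(f, h) \<in> R" "g \<in> orth (mul_rel R)" "h \<in> orth (mul_rel R)"
    by (auto simp: op_part_def)
  have "g - h \<in> mul_rel R" using csubspace_diff[OF assms *(1,2)] by (simp add: mul_rel_def)
  moreover have "g - h \<in> orth (mul_rel R)" by (rule csubspace_diff[OF csubspace_orth *(3,4)])
  ultimately have "cinner (g - h) (g - h) = 0" by (rule orthD[rotated])
  then show "g = h" by simp
qed

text \<open>The multivalued part of the adjoint is \<open>orth (Domain T)\<close>, so its orthogonal
  complement is the closure of the domain. For \<open>T = K\<close> this is how the closure of
  \<open>D0\<close> enters the form.\<close>

lemma op_part_adj_rel_iff:
  fixes T :: "('a::chilbert_space \<times> 'b::complex_inner) set"
  assumes "csubspace T"
  shows "(f, g) \<in> op_part (adj_rel T) \<longleftrightarrow> (f, g) \<in> adj_rel T \<and> g \<in> closure (Domain T)"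
  by (simp add: op_part_def mul_adj_rel orth_orth csubspace_Domain assms)

text \<open>The multivalued part of an adjoint is closed, being an orthogonal complement.
  Subtracting the projection of a second entry onto it stays in the adjoint and makes the entry
  orthogonal to that part.\<close>

lemma Domain_op_part_adj_rel:
  fixes T :: "('a::chilbert_space \<times> 'b::complex_inner) set"
  shows "Domain (op_part (adj_rel T)) = Domain (adj_rel T)"
proof
  show "Domain (op_part (adj_rel T)) \<subseteq> Domain (adj_rel T)" by (auto simp: op_part_def)
  show "Domain (adj_rel T) \<subseteq> Domain (op_part (adj_rel T))"
  proof
    fix f assume "f \<in> Domain (adj_rel T)"
    then obtain g where g: "(f, g) \<in> adj_rel T" by blast
    obtain p where p: "p \<in> mul_rel (adj_rel T)" "g - p \<in> orth (mul_rel (adj_rel T))"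
      using projection_exists[OF csubspace_orth closed_orth] unfolding mul_adj_rel .
    have "(f, g - p) \<in> adj_rel T"
      using csubspace_diff[OF csubspace_adj_rel g p(1)[unfolded mul_rel_def, simplified]] by simp
    with p(2) have "(f, g - p) \<in> op_part (adj_rel T)" by (simp add: op_part_def)
    then show "f \<in> Domain (op_part (adj_rel T))" by blast
  qed
qed

subsection \<open>The Krein extension of a factorized relation\<close>

lemma selfadjoint_opD:
  assumes "selfadjoint_op B"
  shows selfadjoint_op_cinner: "cinner (B x) y = cinner x (B y)"
    and selfadjoint_op_bounded_linear: "bounded_linear B"
    and selfadjoint_op_scaleC: "B (c *\<^sub>C x) = c *\<^sub>C B x"
  using assms by (auto simp: selfadjoint_op_def bounded_op_def)

lemma bounded_linear_id_plus_i:
  assumes "selfadjoint_op B"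
  shows "bounded_linear (id_plus_i B)"
  unfolding id_plus_i_def
  by (intro bounded_linear_add bounded_linear_ident
      bounded_linear_compose[OF bounded_linear_scaleC] selfadjoint_op_bounded_linear assms)

lemma id_plus_i_scaleC:
  assumes "selfadjoint_op B"
  shows "id_plus_i B (c *\<^sub>C x) = c *\<^sub>C id_plus_i B x"
  by (simp add: id_plus_i_def selfadjoint_op_scaleC[OF assms] scaleC_add_right scaleC_scaleC ac_simps)

text \<open>Symmetry makes \<open>cinner (B x) x\<close> real, so the summand with factor i
  contributes only to the imaginary part.\<close>

lemma cinner_id_plus_i_self:
  assumes "selfadjoint_op B"
  shows "Re (cinner (id_plus_i B x) x) = (norm x)\<^sup>2"
    and "Im (cinner (id_plus_i B x) x) = Re (cinner (B x) x)"
proof -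
  have "cinner (B x) x = cnj (cinner (B x) x)"
    by (metis cinner_commute selfadjoint_op_cinner[OF assms])
  from arg_cong[OF this, of Im] have "Im (cinner (B x) x) = 0" by simp
  then show "Re (cinner (id_plus_i B x) x) = (norm x)\<^sup>2"
    and "Im (cinner (id_plus_i B x) x) = Re (cinner (B x) x)"
    by (simp_all add: id_plus_i_def cinner_add_left cinner_scaleC_left cinner_self)
qed

lemma norm_le_norm_id_plus_i:
  assumes "selfadjoint_op B"
  shows "norm x \<le> norm (id_plus_i B x)"
proof (cases "x = 0")
  case False
  have "norm x * norm x = Re (cinner (id_plus_i B x) x)"
    by (simp add: cinner_id_plus_i_self[OF assms] power2_eq_square)
  also have "\<dots> \<le> norm (id_plus_i B x) * norm x"
    using cmod_cinner_le[of "id_plus_i B x" x] complex_Re_le_cmod order_trans by blast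
  finally show ?thesis using False by simp
qed simp

text \<open>Isolates what the Krein argument uses about the sum. The map \<open>E\<close> is
  constrained only on \<open>Domain S\<close>, and its target is a separate space because for a pair
  of relations it is the product space.\<close>

locale factorized_relation =
  fixes S :: "('a::chilbert_space \<times> 'a) set"
    and E :: "'a \<Rightarrow> 'b::chilbert_space"
    and B :: "'b \<Rightarrow> 'b"
  assumes csubspace_S: "csubspace S"
    and selfadjoint_B: "selfadjoint_op B"
    and E_add: "f \<in> Domain S \<Longrightarrow> g \<in> Domain S \<Longrightarrow> E (f + g) = E f + E g"
    and E_scaleC: "f \<in> Domain S \<Longrightarrow> E (c *\<^sub>C f) = c *\<^sub>C E f"
    and factorization: "(f, h) \<in> S \<Longrightarrow> g \<in> Domain S \<Longrightarrow> cinner h g = cinner (id_plus_i B (E f)) (E g)"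
begin

abbreviation C where "C \<equiv> id_plus_i B"

definition K :: "('b \<times> 'a) set" where "K = {(C (E f), h) | f h. (f, h) \<in> S}"

definition q :: "'a cform" where "q = rel_form (S\<inverse>)"

lemmas tendsto_C [tendsto_intros] = bounded_linear.tendsto[OF bounded_linear_id_plus_i[OF selfadjoint_B]]

lemma C_diff: "C (x - y) = C x - C y"
  using linear_diff bounded_linear.linear bounded_linear_id_plus_i[OF selfadjoint_B] by blast

lemma C_add: "C (x + y) = C x + C y"
  using linear_add bounded_linear.linear bounded_linear_id_plus_i[OF selfadjoint_B] by blast

lemma C_zero [simp]: "C 0 = 0"
  using C_diff[of 0 0] by simp

lemma C_scaleC: "C (c *\<^sub>C x) = c *\<^sub>C C x"
  by (rule id_plus_i_scaleC[OF selfadjoint_B])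

lemma norm_le_C: "norm x \<le> norm (C x)"
  by (rule norm_le_norm_id_plus_i[OF selfadjoint_B])

lemma C_inj: "C x = C y \<Longrightarrow> x = y"
  using norm_le_C[of "x - y"] by (simp add: C_diff)

lemma cinner_C_eq_0D: "cinner (C x) x = 0 \<Longrightarrow> x = 0"
  using cinner_id_plus_i_self(1)[OF selfadjoint_B, of x] by simp

text \<open>Since \<open>C\<close> does not decrease norms, a sequence is Cauchy as soon as its
  image under \<open>C\<close> is; in particular \<open>C\<close> has closed range.\<close>

lemma C_cauchy_lift:
  assumes "(\<lambda>n. C (x n)) \<longlonglongrightarrow> d"
  obtains e where "x \<longlonglongrightarrow> e" "d = C e"
proof -
  have "Cauchy x"
  proof (rule metric_CauchyI)
    fix e :: real assume "0 < e"
    with LIMSEQ_imp_Cauchy[OF assms] obtain M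
      where M: "\<And>m n. m \<ge> M \<Longrightarrow> n \<ge> M \<Longrightarrow> dist (C (x m)) (C (x n)) < e"
      unfolding Cauchy_def by blast
    have "dist (x m) (x n) \<le> dist (C (x m)) (C (x n))" for m n
      using norm_le_C[of "x m - x n"] by (simp add: dist_norm C_diff)
    then show "\<exists>M. \<forall>m\<ge>M. \<forall>n\<ge>M. dist (x m) (x n) < e" using M order_le_less_trans by blast
  qed
  then obtain e where e: "x \<longlonglongrightarrow> e" using Cauchy_convergent_iff convergent_def by blast
  then have "(\<lambda>n. C (x n)) \<longlonglongrightarrow> C e" by (rule tendsto_C)
  with assms have "d = C e" by (rule LIMSEQ_unique)
  with e show thesis by (rule that)
qed

lemma S_diff: "(f, h) \<in> S \<Longrightarrow> (g, l) \<in> S \<Longrightarrow> (f - g, h - l) \<in> S"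
  using csubspace_diff[OF csubspace_S, of "(f, h)" "(g, l)"] by simp

lemma E_diff:
  assumes "f \<in> Domain S" "g \<in> Domain S"
  shows "E (f - g) = E f - E g"
proof -
  have "f - g \<in> Domain S" using assms S_diff by blast
  from E_add[OF this assms(2)] show ?thesis by simp
qed

section \<open>The factor \<open>K\<close> and its closure\<close>

lemma csubspace_K: "csubspace K"
  unfolding csubspace_def
proof (intro conjI ballI allI)
  have z: "(0, 0) \<in> S" using csubspace_0[OF csubspace_S] by (simp add: zero_prod_def)
  have "E (0 - 0) = E 0 - E 0" by (rule E_diff) (use z in auto)
  then have "(0, 0) = (C (E 0), 0::'a)" by simp
  then show "0 \<in> K" unfolding K_def zero_prod_def using z by blast
  fix x assume "x \<in> K"
  then obtain f h where x: "x = (C (E f), h)" "(f, h) \<in> S" by (auto simp: K_def)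
  show "c *\<^sub>C x \<in> K" for c
  proof -
    have "(c *\<^sub>C f, c *\<^sub>C h) \<in> S"
      using csubspace_scaleC[OF csubspace_S x(2), of c] by (simp add: scaleC_prod_def)
    moreover have "c *\<^sub>C x = (C (E (c *\<^sub>C f)), c *\<^sub>C h)"
      by (simp add: x scaleC_prod_def C_scaleC E_scaleC[OF DomainI[OF x(2)]])
    ultimately show ?thesis unfolding K_def by blast
  qed
  fix y assume "y \<in> K"
  then obtain g l where y: "y = (C (E g), l)" "(g, l) \<in> S" by (auto simp: K_def)
  have "(f + g, h + l) \<in> S" using csubspace_add[OF csubspace_S x(2) y(2)] by simp
  moreover have "x + y = (C (E (f + g)), h + l)"
    by (simp add: x y C_add E_add[OF DomainI[OF x(2)] DomainI[OF y(2)]])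
  ultimately show "x + y \<in> K" unfolding K_def by blast
qed

lemma adj_adj_K: "adj_rel (adj_rel K) = closure K"
  by (rule adj_adj_rel[OF csubspace_K])

lemma Domain_K: "Domain K = {C (E f) | f. f \<in> Domain S}"
  by (auto simp: K_def)

text \<open>Trades convergence of \<open>C (E (f n))\<close> for convergence of
  \<open>E (f n)\<close> by \<open>C_cauchy_lift\<close>, which is the kind of convergence that the
  form \<open>q\<close> controls.\<close>

lemma closure_K_iff:
  "(d, \<phi>) \<in> closure K \<longleftrightarrow>
    (\<exists>f u e. (\<forall>n. (f n, u n) \<in> S) \<and> u \<longlonglongrightarrow> \<phi> \<and> (\<lambda>n. E (f n)) \<longlonglongrightarrow> e \<and> d = C e)"
proof
  assume "(d, \<phi>) \<in> closure K"
  then obtain w where w: "\<And>n. w n \<in> K" "w \<longlonglongrightarrow> (d, \<phi>)" unfolding closure_sequential by blast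
  have "\<forall>n. \<exists>f. w n = (C (E f), snd (w n)) \<and> (f, snd (w n)) \<in> S"
  proof
    fix n
    show "\<exists>f. w n = (C (E f), snd (w n)) \<and> (f, snd (w n)) \<in> S" using w(1)[of n] by (auto simp: K_def)
  qed
  then obtain f where f: "\<And>n. w n = (C (E (f n)), snd (w n))" "\<And>n. (f n, snd (w n)) \<in> S" by metis
  have "(\<lambda>n. fst (w n)) \<longlonglongrightarrow> d" using tendsto_fst[OF w(2)] by simp
  moreover have "fst (w n) = C (E (f n))" for n using arg_cong[OF f(1)[of n], of fst] by simp
  ultimately have "(\<lambda>n. C (E (f n))) \<longlonglongrightarrow> d" by simp
  then obtain e where e: "(\<lambda>n. E (f n)) \<longlonglongrightarrow> e" "d = C e" by (rule C_cauchy_lift)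
  have "(\<lambda>n. snd (w n)) \<longlonglongrightarrow> \<phi>" using tendsto_snd[OF w(2)] by simp
  with f(2) e show "\<exists>f u e. (\<forall>n. (f n, u n) \<in> S) \<and> u \<longlonglongrightarrow> \<phi> \<and> (\<lambda>n. E (f n)) \<longlonglongrightarrow> e \<and> d = C e"
    by (intro exI[of _ f] exI[of _ "\<lambda>n. snd (w n)"] exI[of _ e]) simp
next
  assume "\<exists>f u e. (\<forall>n. (f n, u n) \<in> S) \<and> u \<longlonglongrightarrow> \<phi> \<and> (\<lambda>n. E (f n)) \<longlonglongrightarrow> e \<and> d = C e"
  then obtain f u e where *: "\<And>n. (f n, u n) \<in> S" "u \<longlonglongrightarrow> \<phi>" "(\<lambda>n. E (f n)) \<longlonglongrightarrow> e" "d = C e"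
    by blast
  have "(\<lambda>n. (C (E (f n)), u n)) \<longlonglongrightarrow> (d, \<phi>)"
    unfolding *(4) by (intro tendsto_intros *)
  moreover have "(C (E (f n)), u n) \<in> K" for n using *(1) by (auto simp: K_def)
  ultimately show "(d, \<phi>) \<in> closure K"
    unfolding closure_sequential by (intro exI[of _ "\<lambda>n. (C (E (f n)), u n)"]) simp
qed

lemma closure_K_C:
  assumes "(d, \<phi>) \<in> closure K"
  obtains e where "d = C e" "e \<in> closure (E ` Domain S)"
proof -
  obtain f u e where *: "\<And>n. (f n, u n) \<in> S" "(\<lambda>n. E (f n)) \<longlonglongrightarrow> e" "d = C e"
    using assms unfolding closure_K_iff by blast
  then have "e \<in> closure (E ` Domain S)"
    unfolding closure_sequential by (intro exI[of _ "\<lambda>n. E (f n)"]) blast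
  with *(3) show thesis by (rule that)
qed

lemma factorization_right:
  assumes "f \<in> Domain S" "(g, l) \<in> S"
  shows "cinner f l = cinner (E f) (C (E g))"
  using factorization[OF assms(2,1)] by (metis cinner_commute)

text \<open>Pairing with \<open>E f\<^sub>n\<close> first and letting the other index tend to infinity replaces a
  closability argument.\<close>

lemma ker_closure_K:
  assumes "(C e, 0) \<in> closure K"
  shows "e = 0"
proof -
  obtain f u e' where *: "\<And>n. (f n, u n) \<in> S" "u \<longlonglongrightarrow> 0" "(\<lambda>n. E (f n)) \<longlonglongrightarrow> e'" "C e = C e'"
    using assms unfolding closure_K_iff by blast
  have e: "e' = e" using *(4) C_inj by simp
  have "cinner (E (f n)) (C e) = 0" for n
  proof -
    have "(\<lambda>m. cinner (E (f n)) (C (E (f m)))) \<longlonglongrightarrow> cinner (E (f n)) (C e')"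
      by (intro tendsto_intros *)
    moreover have "cinner (E (f n)) (C (E (f m))) = cinner (f n) (u m)" for m
      using factorization_right *(1) by (metis DomainI)
    moreover have "(\<lambda>m. cinner (f n) (u m)) \<longlonglongrightarrow> cinner (f n) 0"
      by (intro tendsto_intros *)
    ultimately show ?thesis using LIMSEQ_unique e by fastforce
  qed
  moreover have "(\<lambda>n. cinner (E (f n)) (C e)) \<longlonglongrightarrow> cinner e (C e)"
    using *(3) e by (intro tendsto_intros) auto
  ultimately have "cinner e (C e) = 0" by (simp add: LIMSEQ_const_iff)
  then have "cinner (C e) e = 0" by (metis cinner_commute complex_cnj_zero)
  then show ?thesis by (rule cinner_C_eq_0D)
qed

text \<open>Makes \<open>e\<close> a function of the vector \<phi>, so that the closed form can be
  expressed through it.\<close>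

lemma closure_K_unique:
  assumes "(C e, \<phi>) \<in> closure K" "(C e', \<phi>) \<in> closure K"
  shows "e = e'"
proof -
  have "(C (e - e'), 0) \<in> closure K"
    using csubspace_diff[OF csubspace_closure[OF csubspace_K] assms] by (simp add: C_diff)
  from ker_closure_K[OF this] show ?thesis by simp
qed

section \<open>The form of the inverse relation and its convergent sequences\<close>

lemma q_dom: "form_dom q = Range S"
  by (simp add: q_def rel_form_def)

lemma q_val:
  assumes "(f, h) \<in> S" "(g, l) \<in> S"
  shows "form_val q h l = cinner (E f) (C (E g))"
proof -
  have *: "cinner f' l = cinner (E f) (C (E g))" if f': "(f', h) \<in> S" for f'
  proof -
    \<comment> \<open>Independence of the preimage of \<open>h\<close>: as \<open>f' - f\<close> is
      mapped to 0, the factorization tested on \<open>f' - f\<close> itself gives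
      \<open>cinner (C x) x = 0\<close> for \<open>x = E (f' - f)\<close>, and coercivity forces
      \<open>x = 0\<close>.\<close>
    have d: "(f' - f, 0) \<in> S" using S_diff[OF f' assms(1)] by simp
    then have dom: "f' - f \<in> Domain S" by blast
    from factorization[OF d dom] have "E (f' - f) = 0"
      by (intro cinner_C_eq_0D) simp
    then have "E f' = E f" using E_diff f' assms(1) by (metis DomainI eq_iff_diff_eq_0)
    then show ?thesis using factorization_right f' assms(2) by (metis DomainI)
  qed
  show ?thesis unfolding q_def rel_form_def cform.simps
    by (rule the_equality) (use * assms(1) in \<open>metis converse_iff\<close>)+
qed

text \<open>The lower bound makes \<open>E (f n)\<close> Cauchy along \<open>q\<close>-convergent
  sequences (\<open>q_conv_imp\<close>); the upper bound gives the converse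
  (\<open>q_convI\<close>).\<close>

lemma q_diag_bounds:
  assumes "(f, h) \<in> S"
  shows "(norm (E f))\<^sup>2 \<le> cmod (form_val q h h)"
    and "cmod (form_val q h h) \<le> norm (E f) * norm (C (E f))"
proof -
  have "(norm (E f))\<^sup>2 = Re (cinner (C (E f)) (E f))"
    by (simp add: cinner_id_plus_i_self[OF selfadjoint_B])
  also have "\<dots> = Re (form_val q h h)"
    using q_val[OF assms assms] cinner_commute[of "E f"] by simp
  also have "\<dots> \<le> cmod (form_val q h h)" by (rule complex_Re_le_cmod)
  finally show "(norm (E f))\<^sup>2 \<le> cmod (form_val q h h)" .
  show "cmod (form_val q h h) \<le> norm (E f) * norm (C (E f))"
    using q_val[OF assms assms] cmod_cinner_le[of "E f" "C (E f)"] by simp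
qed

lemma q_conv_imp:
  assumes conv: "form_conv q u \<phi>" and f: "\<And>n. (f n, u n) \<in> S"
  obtains e where "(\<lambda>n. E (f n)) \<longlonglongrightarrow> e" "(C e, \<phi>) \<in> closure K"
proof -
  have "Cauchy (\<lambda>n. E (f n))"
  proof (rule Cauchy_if_norm_power2_le)
    show "(norm (E (f m) - E (f n)))\<^sup>2 \<le> cmod (form_val q (u m - u n) (u m - u n))" for m n
      using q_diag_bounds(1)[OF S_diff[OF f f]] E_diff[OF DomainI[OF f] DomainI[OF f]] by simp
  qed (use conv in \<open>auto simp: form_conv_def\<close>)
  then obtain e where e: "(\<lambda>n. E (f n)) \<longlonglongrightarrow> e" using Cauchy_convergent_iff convergent_def by blast
  moreover have "u \<longlonglongrightarrow> \<phi>" using conv by (simp add: form_conv_def)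
  ultimately have "(C e, \<phi>) \<in> closure K" unfolding closure_K_iff using f by blast
  with e show thesis by (rule that)
qed

lemma q_convI:
  assumes f: "\<And>n. (f n, u n) \<in> S" and u: "u \<longlonglongrightarrow> \<phi>" and e: "(\<lambda>n. E (f n)) \<longlonglongrightarrow> e"
  shows "form_conv q u \<phi>"
  unfolding form_conv_def
proof (intro conjI allI impI)
  show "u n \<in> form_dom q" for n using f q_dom by blast
  show "u \<longlonglongrightarrow> \<phi>" by (rule u)
  fix r :: real assume r: "0 < r"
  obtain M where M: "M > 0" "\<And>x. norm (C x) \<le> norm x * M"
    using bounded_linear.pos_bounded[OF bounded_linear_id_plus_i[OF selfadjoint_B]] by blast
  \<comment> \<open>In the product \<open>norm x * norm (C x)\<close> the bound 1 absorbs the first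
    factor, and \<open>r / M\<close> makes \<open>norm x * M\<close>, which bounds the second,
    smaller than \<open>r\<close>.\<close>
  define s where "s = min 1 (r / M)"
  have s: "s > 0" using r M by (simp add: s_def)
  with LIMSEQ_imp_Cauchy[OF e] obtain N
    where N: "\<And>m n. m \<ge> N \<Longrightarrow> n \<ge> N \<Longrightarrow> dist (E (f m)) (E (f n)) < s"
    unfolding Cauchy_def by blast
  have "cmod (form_val q (u m - u n) (u m - u n)) < r" if "m \<ge> N" "n \<ge> N" for m n
  proof -
    define x where "x = E (f m - f n)"
    have x: "norm x < 1" "norm x * M < r"
      using N[OF that] M(1)
      by (auto simp: dist_norm x_def s_def less_divide_eq E_diff[OF DomainI[OF f] DomainI[OF f]])
    have "cmod (form_val q (u m - u n) (u m - u n)) \<le> norm x * norm (C x)"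
      unfolding x_def by (rule q_diag_bounds(2)[OF S_diff[OF f f]])
    also have "\<dots> \<le> 1 * (norm x * M)" using x(1) M by (intro mult_mono) auto
    finally show ?thesis using x(2) by simp
  qed
  then show "\<exists>N. \<forall>m\<ge>N. \<forall>n\<ge>N. cmod (form_val q (u m - u n) (u m - u n)) < r" by blast
qed

section \<open>The closure of the form and the relation that it represents\<close>

lemma form_dom_closure_q: "form_dom (form_closure q) = {\<phi>. \<exists>e. (C e, \<phi>) \<in> closure K}"
proof (intro set_eqI iffI)
  fix \<phi> assume "\<phi> \<in> form_dom (form_closure q)"
  then obtain u where u: "form_conv q u \<phi>" by (auto simp: form_closure_def)
  then have "\<forall>n. \<exists>f. (f, u n) \<in> S" by (auto simp: form_conv_def q_dom)
  then obtain f where "\<And>n. (f n, u n) \<in> S" by metis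
  from q_conv_imp[OF u this] show "\<phi> \<in> {\<phi>. \<exists>e. (C e, \<phi>) \<in> closure K}" by blast
next
  fix \<phi> assume "\<phi> \<in> {\<phi>. \<exists>e. (C e, \<phi>) \<in> closure K}"
  then obtain f u e where "\<And>n. (f n, u n) \<in> S" "u \<longlonglongrightarrow> \<phi>" "(\<lambda>n. E (f n)) \<longlonglongrightarrow> e"
    unfolding closure_K_iff by blast
  from q_convI[OF this] show "\<phi> \<in> form_dom (form_closure q)" by (auto simp: form_closure_def)
qed

text \<open>The value of \<open>form_closure\<close> is a limit common to all approximating
  sequences. Every choice of preimages leads to the same \<open>e\<close> and \<open>e'\<close> by
  \<open>closure_K_unique\<close>, and at least one pair of sequences exists, so the description
  determines exactly one number.\<close>

lemma form_val_closure_q: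
  assumes "(C e, \<phi>) \<in> closure K" "(C e', \<psi>) \<in> closure K"
  shows "form_val (form_closure q) \<phi> \<psi> = cinner e (C e')"
proof -
  have lim: "(\<lambda>n. form_val q (u n) (v n)) \<longlonglongrightarrow> cinner e (C e')"
    if u: "form_conv q u \<phi>" and v: "form_conv q v \<psi>" for u v
  proof -
    have "\<forall>n. \<exists>f. (f, u n) \<in> S" "\<forall>n. \<exists>f. (f, v n) \<in> S"
      using u v by (auto simp: form_conv_def q_dom)
    then obtain f g where fg: "\<And>n. (f n, u n) \<in> S" "\<And>n. (g n, v n) \<in> S" by metis
    obtain e1 where e1: "(\<lambda>n. E (f n)) \<longlonglongrightarrow> e1" "(C e1, \<phi>) \<in> closure K"
      by (rule q_conv_imp[OF u fg(1)])
    obtain e2 where e2: "(\<lambda>n. E (g n)) \<longlonglongrightarrow> e2" "(C e2, \<psi>) \<in> closure K"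
      by (rule q_conv_imp[OF v fg(2)])
    have "e1 = e" "e2 = e'" using closure_K_unique e1(2) e2(2) assms by blast+
    with e1(1) e2(1) have "(\<lambda>n. cinner (E (f n)) (C (E (g n)))) \<longlonglongrightarrow> cinner e (C e')"
      by (intro tendsto_intros) auto
    then show ?thesis by (simp add: q_val[OF fg])
  qed
  have "\<phi> \<in> form_dom (form_closure q)" "\<psi> \<in> form_dom (form_closure q)"
    using assms by (auto simp: form_dom_closure_q)
  then obtain u v where uv: "form_conv q u \<phi>" "form_conv q v \<psi>" by (auto simp: form_closure_def)
  show ?thesis unfolding form_closure_def cform.simps
  proof (rule the_equality)
    fix l assume "\<forall>u v. form_conv q u \<phi> \<longrightarrow> form_conv q v \<psi> \<longrightarrow> (\<lambda>n. form_val q (u n) (v n)) \<longlonglongrightarrow> l"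
    with uv have "(\<lambda>n. form_val q (u n) (v n)) \<longlonglongrightarrow> l" by blast
    from LIMSEQ_unique[OF this lim[OF uv]] show "l = cinner e (C e')" .
  qed (use lim in blast)
qed

text \<open>Passing to the inverse makes \<open>b\<close> the argument of the closed form and
  \<open>a\<close> its representing vector. With \<open>w\<close> attached to \<open>b\<close>, the
  representing condition says that \<open>(a, w)\<close> satisfies the adjoint identity against the
  closure of \<open>K\<close>, equivalently against \<open>K\<close>.\<close>

lemma krein_iff: "(a, b) \<in> krein S \<longleftrightarrow> (\<exists>w. (a, w) \<in> adj_rel K \<and> (C w, b) \<in> closure K)"
proof
  assume "(a, b) \<in> krein S"
  then have ab: "b \<in> form_dom (form_closure q)"
    "\<And>\<psi>. \<psi> \<in> form_dom (form_closure q) \<Longrightarrow> form_val (form_closure q) b \<psi> = cinner a \<psi>"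
    by (auto simp: krein_def friedrichs_def form_rel_def q_def)
  then obtain w where w: "(C w, b) \<in> closure K" by (auto simp: form_dom_closure_q)
  have "(a, w) \<in> adj_rel K"
    unfolding adj_rel_iff
  proof (intro allI impI)
    fix d \<psi> assume "(d, \<psi>) \<in> K"
    then have d: "(d, \<psi>) \<in> closure K" using closure_subset by blast
    then obtain e where e: "d = C e" using closure_K_C by blast
    then have "\<psi> \<in> form_dom (form_closure q)" using d by (auto simp: form_dom_closure_q)
    from ab(2)[OF this] form_val_closure_q[OF w] d e show "cinner a \<psi> = cinner w d" by simp
  qed
  with w show "\<exists>w. (a, w) \<in> adj_rel K \<and> (C w, b) \<in> closure K" by blast
next
  assume "\<exists>w. (a, w) \<in> adj_rel K \<and> (C w, b) \<in> closure K"
  then obtain w where w: "(a, w) \<in> adj_rel K" "(C w, b) \<in> closure K" by blast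
  have "form_val (form_closure q) b \<psi> = cinner a \<psi>" if \<psi>: "\<psi> \<in> form_dom (form_closure q)" for \<psi>
  proof -
    obtain e where e: "(C e, \<psi>) \<in> closure K" using \<psi> unfolding form_dom_closure_q by blast
    \<comment> \<open>The closure of \<open>K\<close> is the adjoint of \<open>adj_rel K\<close>, so
      the pair \<open>(C e, \<psi>)\<close> may be tested on \<open>(a, w)\<close>.\<close>
    then have "cinner (C e) w = cinner \<psi> a"
      using adj_relD[of "C e" \<psi> "adj_rel K"] w(1) by (simp add: adj_adj_K)
    then have "cinner w (C e) = cinner a \<psi>" by (metis cinner_commute)
    then show ?thesis using form_val_closure_q[OF w(2) e] by simp
  qed
  then show "(a, b) \<in> krein S"
    using w(2) by (auto simp: krein_def friedrichs_def form_rel_def form_dom_closure_q q_def[symmetric])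
qed

theorem krein_eq: "krein S = adj_rel (adj_rel K) \<bullet>\<^sub>r op_graph C \<bullet>\<^sub>r adj_rel K"
  unfolding adj_adj_K by (auto simp: krein_iff rel_prod_def op_graph_def relcomp_unfold) blast

section \<open>The closed form of the Krein extension\<close>

definition krein_form :: "'a cform" where
  "krein_form = \<lparr>form_dom = Domain (adj_rel K),
     form_val = (\<lambda>f g. cinner (C (rel_app (op_part (adj_rel K)) f)) (rel_app (op_part (adj_rel K)) g))\<rparr>"

abbreviation P where "P \<equiv> rel_app (op_part (adj_rel K))"

lemma P_mem:
  assumes "f \<in> Domain (adj_rel K)"
  shows "(f, P f) \<in> adj_rel K" and "P f \<in> closure (Domain K)"
  using rel_app_mem[OF single_valued_op_part[OF csubspace_adj_rel], of f K] assms
  by (simp_all add: Domain_op_part_adj_rel op_part_adj_rel_iff csubspace_K)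

lemma P_eq: "(f, g) \<in> adj_rel K \<Longrightarrow> g \<in> closure (Domain K) \<Longrightarrow> P f = g"
  by (intro rel_app_eq single_valued_op_part csubspace_adj_rel) (simp add: op_part_adj_rel_iff csubspace_K)

lemmas P_linear = rel_app_linear[OF csubspace_op_part[OF csubspace_adj_rel]
    single_valued_op_part[OF csubspace_adj_rel], of _ K, unfolded Domain_op_part_adj_rel]

lemma sectorial_form_krein_form: "sectorial_form krein_form"
proof -
  \<comment> \<open>A norm bound \<open>M\<close> of \<open>B\<close> provides the semi-angle
    \<open>arctan M\<close>: the imaginary part of \<open>cinner (C x) x\<close> is the real number
    \<open>cinner (B x) x\<close>, and the real part is \<open>(norm x)\<^sup>2\<close>.\<close>
  obtain M where M: "M > 0" "\<And>x. norm (B x) \<le> norm x * M"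
    using bounded_linear.pos_bounded[OF selfadjoint_op_bounded_linear[OF selfadjoint_B]] by blast
  have "\<bar>Im (cinner (C x) x)\<bar> \<le> tan (arctan M) * Re (cinner (C x) x)" for x
  proof -
    have "\<bar>Im (cinner (C x) x)\<bar> \<le> cmod (cinner (B x) x)"
      by (simp add: cinner_id_plus_i_self[OF selfadjoint_B] abs_Re_le_cmod)
    also have "\<dots> \<le> norm (B x) * norm x" by (rule cmod_cinner_le)
    also have "\<dots> \<le> norm x * M * norm x" by (intro mult_right_mono M) simp
    finally show ?thesis
      by (simp add: cinner_id_plus_i_self[OF selfadjoint_B] tan_arctan power2_eq_square ac_simps)
  qed
  moreover have "0 \<le> arctan M" "arctan M < pi / 2" using M(1) arctan_ubound by auto
  moreover have "sesquilinear_form krein_form"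
    using csubspace_Domain[OF csubspace_adj_rel]
    by (simp add: sesquilinear_form_def krein_form_def P_linear C_add C_scaleC cinner_add_left
        cinner_add_right cinner_scaleC_left cinner_scaleC_right)
  ultimately show ?thesis
    unfolding sectorial_form_def by (intro conjI exI[of _ "arctan M"]) (simp_all add: krein_form_def)
qed

text \<open>The real part of the form is the squared norm of \<open>P\<close>, so
  \<open>P (u n)\<close> converges. Its limit is \<open>P\<close> at the limit point because the
  adjoint and the closure of \<open>Domain K\<close> are both closed.\<close>

lemma closed_form_krein_form: "closed_form krein_form"
  unfolding closed_form_def
proof (intro allI impI)
  fix u \<phi> assume conv: "form_conv krein_form u \<phi>"
  then have dom: "\<And>n. u n \<in> Domain (adj_rel K)" and u: "u \<longlonglongrightarrow> \<phi>"
    by (auto simp: form_conv_def krein_form_def)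
  have "Cauchy (\<lambda>n. P (u n))"
  proof (rule Cauchy_if_norm_power2_le)
    fix m n
    have "(norm (P (u m) - P (u n)))\<^sup>2 = Re (form_val krein_form (u m - u n) (u m - u n))"
      by (simp add: krein_form_def P_linear dom cinner_id_plus_i_self[OF selfadjoint_B])
    then show "(norm (P (u m) - P (u n)))\<^sup>2 \<le> cmod (form_val krein_form (u m - u n) (u m - u n))"
      by (simp add: complex_Re_le_cmod)
  qed (use conv in \<open>auto simp: form_conv_def\<close>)
  then obtain w where w: "(\<lambda>n. P (u n)) \<longlonglongrightarrow> w" using Cauchy_convergent_iff convergent_def by blast
  have \<phi>: "(\<phi>, w) \<in> adj_rel K" by (rule adj_rel_sequential[OF P_mem(1)[OF dom] u w])
  moreover have "w \<in> closure (Domain K)"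
    using closed_sequentially[OF closed_closure _ w] P_mem(2)[OF dom] by blast
  ultimately have Pw: "P \<phi> = w" by (rule P_eq)
  have "(\<lambda>n. cinner (C (P (u n) - w)) (P (u n) - w)) \<longlonglongrightarrow> cinner (C (w - w)) (w - w)"
    by (intro tendsto_intros w)
  then have "(\<lambda>n. form_val krein_form (u n - \<phi>) (u n - \<phi>)) \<longlonglongrightarrow> 0"
    using \<phi> by (simp add: krein_form_def P_linear dom Pw DomainI)
  with \<phi> show "\<phi> \<in> form_dom krein_form \<and> (\<lambda>n. form_val krein_form (u n - \<phi>) (u n - \<phi>)) \<longlonglongrightarrow> 0"
    by (auto simp: krein_form_def)
qed

text \<open>The equality of closures enters in both inclusions: it keeps \<open>C (P a)\<close>
  inside the closure of \<open>Domain K\<close>, and it identifies the intermediate vector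
  \<open>w\<close> of \<open>krein_iff\<close> with \<open>P a\<close>.\<close>

theorem corresponding_form_krein:
  assumes eq: "closure (E ` Domain S) = closure (Domain K)"
  shows "corresponding_form krein_form (krein S)"
proof -
  have "form_rel krein_form = krein S"
  proof (intro subset_antisym subrelI)
    fix a b assume "(a, b) \<in> form_rel krein_form"
    then have a: "a \<in> Domain (adj_rel K)"
      and ab: "\<And>g. g \<in> Domain (adj_rel K) \<Longrightarrow> cinner (C (P a)) (P g) = cinner b g"
      by (auto simp: form_rel_def krein_form_def)
    have "P a \<in> closure (E ` Domain S)" using P_mem(2)[OF a] eq by simp
    then obtain e where e: "\<And>n. e n \<in> E ` Domain S" "e \<longlonglongrightarrow> P a"
      unfolding closure_sequential by blast
    have "(\<lambda>n. C (e n)) \<longlonglongrightarrow> C (P a)" by (intro tendsto_intros e)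
    moreover have "C (e n) \<in> Domain K" for n using e(1)[of n] by (auto simp: Domain_K)
    ultimately have Ca: "C (P a) \<in> closure (Domain K)"
      unfolding closure_sequential by (intro exI[of _ "\<lambda>n. C (e n)"]) simp
    have "(C (P a), b) \<in> adj_rel (adj_rel K)"
      unfolding adj_rel_iff[of "C (P a)"]
    proof (intro allI impI)
      fix g x assume g: "(g, x) \<in> adj_rel K"
      then have dom: "g \<in> Domain (adj_rel K)" by blast
      \<comment> \<open>The form tests only the representative \<open>P g\<close>. Any other second
        entry \<open>x\<close> differs from it by a vector orthogonal to the closure of
        \<open>Domain K\<close>, hence to \<open>C (P a)\<close>.\<close>
      have "x - P g \<in> mul_rel (adj_rel K)"
        using csubspace_diff[OF csubspace_adj_rel g P_mem(1)[OF dom]] by (simp add: mul_rel_def)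
      then have "x - P g \<in> orth (closure (Domain K))" by (simp add: mul_adj_rel orth_closure)
      from orthD'[OF this Ca] show "cinner (C (P a)) x = cinner b g"
        by (simp add: cinner_diff_right ab[OF dom])
    qed
    with P_mem(1)[OF a] show "(a, b) \<in> krein S" by (auto simp: krein_iff adj_adj_K)
  next
    fix a b assume "(a, b) \<in> krein S"
    then obtain w where w: "(a, w) \<in> adj_rel K" "(C w, b) \<in> closure K" by (auto simp: krein_iff)
    have "w \<in> closure (Domain K)"
      using closure_K_C[OF w(2)] C_inj eq by metis
    from P_eq[OF w(1) this] have "P a = w" .
    moreover have "cinner (C w) (P g) = cinner b g" if "g \<in> Domain (adj_rel K)" for g
      using w(2) P_mem(1)[OF that] by (metis adj_relD adj_adj_K)
    ultimately show "(a, b) \<in> form_rel krein_form"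
      using w(1) by (auto simp: form_rel_def krein_form_def)
  qed
  then show ?thesis
    by (simp add: corresponding_form_def sectorial_form_krein_form closed_form_krein_form)
qed

end

subsection \<open>Sums of maximal sectorial relations\<close>

lemma sectorial_dataD:
  assumes "sectorial_data H t A R B"
  shows "csubspace R" "single_valued R" "selfadjoint_op B" "form_dom t = Domain R"
    and "Domain (rel_sqrt A R) = Domain R"
    and "\<And>h k. h \<in> Domain R \<Longrightarrow> k \<in> Domain R \<Longrightarrow>
      form_val t h k = cinner (id_plus_i B (rel_app R h)) (rel_app R k)"
    and "mul_rel A = orth (Domain R)"
    and "R \<subseteq> orth (mul_rel A) \<times> orth (mul_rel A)"
    and "adj_rel R \<inter> orth (mul_rel A) \<times> orth (mul_rel A) = R"
    and "\<And>x. B x \<in> orth (mul_rel A)"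
    and "\<And>f f'. (f, f') \<in> H \<longleftrightarrow> f \<in> Domain R \<and> (\<forall>g\<in>Domain R. form_val t f g = cinner f' g)"
proof -
  note d = assms[unfolded sectorial_data_def]
  show R: "csubspace R" "single_valued R"
    and "R \<subseteq> orth (mul_rel A) \<times> orth (mul_rel A)"
    and "adj_rel R \<inter> orth (mul_rel A) \<times> orth (mul_rel A) = R"
    using d by (auto simp: op_part_sqrt_def Let_def)
  show B: "selfadjoint_op B" using d by blast
  have t: "sesquilinear_form t"
    using d by (auto simp: corresponding_form_def sectorial_form_def)
  have A: "A = form_rel (re_form t)" using d by blast
  have z: "0 \<in> form_dom t" using t by (simp add: sesquilinear_form_def csubspace_0)
  have t0: "form_val t 0 g = 0 \<and> form_val t g 0 = 0" if "g \<in> form_dom t" for g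
  proof -
    have "form_val t (0 *\<^sub>C 0) g = 0 * form_val t 0 g" "form_val t g (0 *\<^sub>C 0) = cnj 0 * form_val t g 0"
      using t z that unfolding sesquilinear_form_def by blast+
    then show ?thesis by simp
  qed
  \<comment> \<open>The form vanishes when its first argument is 0, so \<open>(0, k)\<close> belongs
    to the relation of the real part exactly when \<open>k\<close> annihilates the form
    domain.\<close>
  have mul: "mul_rel A = orth (form_dom t)"
    using z by (auto simp: A mul_rel_def form_rel_def re_form_def orth_def t0)
  then have "0 \<in> mul_rel A" using csubspace_0[OF csubspace_orth] by blast
  then show dom: "Domain (rel_sqrt A R) = Domain R" by (auto simp: rel_sqrt_def)
  then show "form_dom t = Domain R" using d by simp
  with mul show "mul_rel A = orth (Domain R)" by simp
  show "form_val t h k = cinner (id_plus_i B (rel_app R h)) (rel_app R k)"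
    if "h \<in> Domain R" "k \<in> Domain R" for h k
    using d dom that by simp
  have "H = form_rel t" using d by (simp add: corresponding_form_def)
  then show "(f, f') \<in> H \<longleftrightarrow> f \<in> Domain R \<and> (\<forall>g\<in>Domain R. form_val t f g = cinner f' g)" for f f'
    using \<open>form_dom t = Domain R\<close> by (simp add: form_rel_def)
  \<comment> \<open>The data give \<open>B\<close> zero on sums from the kernel and the multivalued
    part; the kernel vector 0 isolates the latter, and symmetry turns this into orthogonality of the
    range of \<open>B\<close> to \<open>mul_rel A\<close>.\<close>
  have "0 \<in> ker_rel A" using z by (auto simp: A ker_rel_def form_rel_def re_form_def t0)
  then have "B (0 + k) = 0" if "k \<in> mul_rel A" for k using d that by blast
  then show "B x \<in> orth (mul_rel A)" for x
    by (simp add: orth_def selfadjoint_op_cinner[OF B])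
qed

text \<open>Derives \<open>H = A^{1/2} (I + i B) A^{1/2}\<close> pointwise from the form
  representation. Selfadjointness of \<open>R\<close> holds only inside \<open>?M\<close>, so
  \<open>f'\<close> is first split into its component in \<open>?M\<close> and a multivalued
  remainder.\<close>

lemma sectorial_data_mem_iff:
  fixes H :: "('a::chilbert_space \<times> 'a) set"
  assumes data: "sectorial_data H t A R B"
  shows "(f, f') \<in> H \<longleftrightarrow> f \<in> Domain R \<and> (id_plus_i B (rel_app R f), f') \<in> rel_sqrt A R"
proof -
  note D = sectorial_dataD[OF data]
  let ?M = "orth (mul_rel A)" and ?x = "id_plus_i B (rel_app R f)"
  show ?thesis
  proof
    assume "(f, f') \<in> H"
    then have f: "f \<in> Domain R" and form: "\<And>g. g \<in> Domain R \<Longrightarrow> form_val t f g = cinner f' g"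
      by (auto simp: D(11))
    have "rel_app R f \<in> ?M" using rel_app_mem[OF D(2) f] D(8) by blast
    then have x: "?x \<in> ?M"
      unfolding id_plus_i_def by (intro csubspace_add csubspace_scaleC csubspace_orth D(10))
    obtain m where m: "m \<in> ?M" "f' - m \<in> orth ?M"
      by (rule projection_exists[OF csubspace_orth closed_orth, of "mul_rel A" f'])
    have sub: "Domain R \<subseteq> ?M" using D(8) by blast
    \<comment> \<open>The remainder is orthogonal to \<open>?M\<close>, which contains
      \<open>Domain R\<close>, and \<open>mul_rel A\<close> is the orthogonal complement of
      \<open>Domain R\<close>.\<close>
    then have k: "f' - m \<in> mul_rel A" using m(2) unfolding D(7) by (auto simp: orth_def)
    have "(?x, m) \<in> adj_rel R"
      unfolding adj_rel_iff
    proof (intro allI impI)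
      fix g g' assume g: "(g, g') \<in> R"
      then have gd: "g \<in> Domain R" by blast
      have "cinner ?x g' = cinner f' g"
        using form[OF gd] D(6)[OF f gd] rel_app_eq[OF D(2) g] by simp
      also have "\<dots> = cinner m g"
        using orthD[OF m(2), of g] sub gd by (auto simp: cinner_diff_left)
      finally show "cinner ?x g' = cinner m g" .
    qed
    with x m(1) have "(?x, m) \<in> R" using D(9) by blast
    moreover have "f' = m + (f' - m)" by simp
    ultimately have "(?x, f') \<in> rel_sqrt A R" using k unfolding rel_sqrt_def by blast
    with f show "f \<in> Domain R \<and> (?x, f') \<in> rel_sqrt A R" by blast
  next
    assume "f \<in> Domain R \<and> (?x, f') \<in> rel_sqrt A R"
    then have f: "f \<in> Domain R" and "(?x, f') \<in> rel_sqrt A R" by blast+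
    then obtain m k where mk: "f' = m + k" "(?x, m) \<in> R" "k \<in> mul_rel A" by (auto simp: rel_sqrt_def)
    have adj: "(?x, m) \<in> adj_rel R" using mk(2) D(9) by blast
    have "form_val t f g = cinner f' g" if g: "g \<in> Domain R" for g
    proof -
      have "cinner ?x (rel_app R g) = cinner m g" by (rule adj_relD[OF adj rel_app_mem[OF D(2) g]])
      moreover have "cinner k g = 0" using mk(3) g unfolding D(7) by (rule orthD)
      ultimately show ?thesis using D(6)[OF f g] by (simp add: mk(1) cinner_add_left)
    qed
    with f show "(f, f') \<in> H" by (simp add: D(11))
  qed
qed

lemma selfadjoint_op_oplus:
  assumes "selfadjoint_op B1" "selfadjoint_op B2"
  shows "selfadjoint_op (oplus B1 B2)"
  unfolding selfadjoint_op_def bounded_op_def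
proof (intro conjI allI)
  have "bounded_linear (\<lambda>z. (B1 (fst z), B2 (snd z)))"
    using assms[THEN selfadjoint_op_bounded_linear]
    by (intro bounded_linear_Pair bounded_linear_compose[OF _ bounded_linear_fst]
        bounded_linear_compose[OF _ bounded_linear_snd])
  then show "bounded_linear (oplus B1 B2)" by (simp add: oplus_def case_prod_unfold)
  show "oplus B1 B2 (c *\<^sub>C z) = c *\<^sub>C oplus B1 B2 z" for c z
    by (cases z) (simp add: oplus_def scaleC_prod_def assms[THEN selfadjoint_op_scaleC])
  show "cinner (oplus B1 B2 x) y = cinner x (oplus B1 B2 y)" for x y
    by (cases x; cases y) (simp add: oplus_def cinner_prod_def assms[THEN selfadjoint_op_cinner])
qed

lemma id_plus_i_oplus: "id_plus_i (oplus B1 B2) (x, y) = (id_plus_i B1 x, id_plus_i B2 y)"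
  by (simp add: id_plus_i_def oplus_def scaleC_prod_def)

lemma csubspace_rel_sum:
  fixes S T :: "('a::complex_inner \<times> 'b::complex_inner) set"
  assumes "csubspace S" "csubspace T"
  shows "csubspace (S +\<^sub>r T)"
  unfolding csubspace_def
proof (intro conjI ballI allI)
  have "(0, 0) \<in> S" "(0, 0) \<in> T" using assms by (auto dest: csubspace_0 simp: zero_prod_def)
  then have "(0, 0 + 0) \<in> S +\<^sub>r T" unfolding rel_sum_def by blast
  then show "0 \<in> S +\<^sub>r T" by (simp add: zero_prod_def)
  fix x assume "x \<in> S +\<^sub>r T"
  then obtain f g h where x: "x = (f, g + h)" "(f, g) \<in> S" "(f, h) \<in> T" by (auto simp: rel_sum_def)
  show "c *\<^sub>C x \<in> S +\<^sub>r T" for c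
    using csubspace_scaleC[OF assms(1) x(2), of c] csubspace_scaleC[OF assms(2) x(3), of c]
    by (auto simp: x(1) rel_sum_def scaleC_prod_def scaleC_add_right)
  fix y assume "y \<in> S +\<^sub>r T"
  then obtain f' g' h' where y: "y = (f', g' + h')" "(f', g') \<in> S" "(f', h') \<in> T"
    by (auto simp: rel_sum_def)
  have "(f + f', g + g') \<in> S" "(f + f', h + h') \<in> T"
    using csubspace_add[OF assms(1) x(2) y(2)] csubspace_add[OF assms(2) x(3) y(3)] by simp_all
  then have "(f + f', (g + g') + (h + h')) \<in> S +\<^sub>r T" unfolding rel_sum_def by blast
  then show "x + y \<in> S +\<^sub>r T" by (simp add: x(1) y(1) ac_simps)
qed

lemma Domain_rel_sum: "Domain (S +\<^sub>r T) = Domain S \<inter> Domain T"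
  by (auto simp: rel_sum_def)

theorem theorem3p3:
  fixes H1 H2 A1 A2 R1 R2 :: "('a::chilbert_space \<times> 'a) set"
    and t1 t2 :: "'a cform"
    and B1 B2 :: "'a \<Rightarrow> 'a"
    and K :: "(('a \<times> 'a) \<times> 'a) set"
    and E0 D0 :: "('a \<times> 'a) set"
  assumes "maximal_sectorial H1"
    and "maximal_sectorial H2"
    and "sectorial_data H1 t1 A1 R1 B1"
    and "sectorial_data H2 t2 A2 R2 B2"
    and "K = K_rel A1 R1 B1 A2 R2 B2"
    and "E0 = {(rel_app R1 f, rel_app R2 f) | f. f \<in> Domain H1 \<inter> Domain H2}"
    and "D0 = {(id_plus_i B1 (rel_app R1 f), id_plus_i B2 (rel_app R2 f)) | f.
                 f \<in> Domain H1 \<inter> Domain H2}"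
  shows "krein (H1 +\<^sub>r H2) =
           adj_rel (adj_rel K) \<bullet>\<^sub>r op_graph (id_plus_i (oplus B1 B2)) \<bullet>\<^sub>r adj_rel K
         \<and> (closure E0 = closure D0 \<longrightarrow>
           corresponding_form
             \<lparr>form_dom = Domain (adj_rel K),
              form_val = (\<lambda>f g. cinner
                (id_plus_i (oplus B1 B2) (rel_app (op_part (adj_rel K)) f))
                (rel_app (op_part (adj_rel K)) g))\<rparr>
             (krein (H1 +\<^sub>r H2)))"
proof -
  note H1 = sectorial_dataD[OF assms(3)] and H2 = sectorial_dataD[OF assms(4)]
  define E where "E f = (rel_app R1 f, rel_app R2 f)" for f
  have dom: "f \<in> Domain R1" "f \<in> Domain R2" if "f \<in> Domain (H1 +\<^sub>r H2)" for f
    using that by (auto simp: Domain_rel_sum sectorial_data_mem_iff[OF assms(3)]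
        sectorial_data_mem_iff[OF assms(4)])
  interpret S: factorized_relation "H1 +\<^sub>r H2" E "oplus B1 B2"
  proof
    show "csubspace (H1 +\<^sub>r H2)"
      using assms(1,2) by (intro csubspace_rel_sum) (auto simp: maximal_sectorial_def sectorial_def)
    show "selfadjoint_op (oplus B1 B2)" by (rule selfadjoint_op_oplus[OF H1(3) H2(3)])
    show "E (f + g) = E f + E g" if "f \<in> Domain (H1 +\<^sub>r H2)" "g \<in> Domain (H1 +\<^sub>r H2)" for f g
      using dom[OF that(1)] dom[OF that(2)] H1(1,2) H2(1,2) by (simp add: E_def rel_app_add)
    show "E (c *\<^sub>C f) = c *\<^sub>C E f" if "f \<in> Domain (H1 +\<^sub>r H2)" for f c
      using dom[OF that] H1(1,2) H2(1,2) by (simp add: E_def rel_app_scaleC scaleC_prod_def)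
    show "cinner h g = cinner (id_plus_i (oplus B1 B2) (E f)) (E g)"
      if fh: "(f, h) \<in> H1 +\<^sub>r H2" and g: "g \<in> Domain (H1 +\<^sub>r H2)" for f h g
    proof -
      obtain h1 h2 where h: "h = h1 + h2" "(f, h1) \<in> H1" "(f, h2) \<in> H2"
        using fh by (auto simp: rel_sum_def)
      have f: "f \<in> Domain R1" "f \<in> Domain R2" using dom fh by blast+
      have "form_val t1 f g = cinner h1 g" using h(2) dom(1)[OF g] unfolding H1(11) by blast
      moreover have "form_val t2 f g = cinner h2 g" using h(3) dom(2)[OF g] unfolding H2(11) by blast
      ultimately have "cinner h1 g = cinner (id_plus_i B1 (rel_app R1 f)) (rel_app R1 g)"
        "cinner h2 g = cinner (id_plus_i B2 (rel_app R2 f)) (rel_app R2 g)"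
        using H1(6)[OF f(1) dom(1)[OF g]] H2(6)[OF f(2) dom(2)[OF g]] by simp_all
      then show ?thesis by (simp add: h(1) E_def id_plus_i_oplus cinner_prod_def cinner_add_left)
    qed
  qed
  \<comment> \<open>Describes the sum by the very conditions occurring in \<open>K_rel\<close>: the
    existence of both second entries there amounts to membership of \<open>f\<close> in both
    domains.\<close>
  have mem_sum: "(f, h) \<in> H1 +\<^sub>r H2 \<longleftrightarrow> (\<exists>f1 f2. h = f1 + f2 \<and>
      f \<in> Domain R1 \<and> (id_plus_i B1 (rel_app R1 f), f1) \<in> rel_sqrt A1 R1 \<and>
      f \<in> Domain R2 \<and> (id_plus_i B2 (rel_app R2 f), f2) \<in> rel_sqrt A2 R2)" for f h
    using sectorial_data_mem_iff[OF assms(3)] sectorial_data_mem_iff[OF assms(4)]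
    by (auto simp: rel_sum_def)
  have K: "K = S.K"
    unfolding assms(5) K_rel_def S.K_def H1(5) H2(5) E_def id_plus_i_oplus mem_sum by blast
  have E0: "E0 = E ` Domain (H1 +\<^sub>r H2)"
    unfolding assms(6) E_def Domain_rel_sum by blast
  have D0: "D0 = Domain S.K"
    unfolding assms(7) S.Domain_K E_def id_plus_i_oplus Domain_rel_sum by blast
  show ?thesis
    using S.krein_eq S.corresponding_form_krein unfolding S.krein_form_def K E0 D0 by blast
qed

end
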